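(* Let $G_t$ be the true transfer matrix and $\Lambda_0$ a perturbation matrix, and for $\epsilon\ge 0$ let $G=(I+\epsilon\Lambda_0)G_t$. Then there exists an $r>0$ such that for all $\epsilon<r$ the reconstruction problem with data $G$ is solvable by Method $M_2$. Specifically, for every non-allowable structure $n$ and every allowable structure $a$ with the same number of links, $$\delta_n^2(\epsilon)-\delta_a^2(\epsilon)=B_n+F_{na}(\epsilon),$$ where the constant $B_n$ satisfies $B_n>0$ and $|F_{na}(\epsilon)|<B_n$ for all $\epsilon<r$.
   Context: Setting. An LTI system $\dot x=Ax+Bu$, $y=[\,I\ \ 0\,]x$ with $p$ measured states $y$ (and some hidden states) is represented by its dynamical structure function $(Q,P)$: $Y=QY+PU$ in the Laplace domain, with $Q,P$ strictly proper transfer matrices and $Q$ hollow (zero diagonal). A pair $(Q,P)$ is related to the transfer matrix by $G=(I-Q)^{-1}P$. Standing assumption (experimental protocol): $p$ inputs are applied, each directly and uniquely affecting only one measured state, so that $P$ is diagonal and all transfer matrices are $p\times p$; the transfer matrix is of full rank. Under this assumption $(Q,P)$ is uniquely determined by the true transfer matrix $G_t$. Boolean structures. A Boolean internal structure $i$ prescribes which off-diagonal entries of a $p\times p$ matrix are constrained to be zero; the unconstrained off-diagonal entries are called its links (so there are $2^{p^2-p}$ structures, and the fully-connected one has $p^2-p$ links). The true Boolean structure is the zero pattern $\mathcal{B}(Q)$ of the off-diagonal part of $Q$ for the pair $(Q,P)$ determined by $G_t$. With $X=P^{-1}(I-Q)$, which has the same off-diagonal zero pattern as $Q$, let $\mathcal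 X_i$ be the set of all $p\times p$ matrices $X$ of functions of $s=j\omega$ satisfying the zero constraints of structure $i$ (no other constraint is imposed). For data $G$ define $$\delta_i^2=\inf_{X\in\mathcal X_i}\|GX-I\|_F^2,\qquad \|\Delta\|_F^2=\frac1{2\pi}\int_{-\infty}^{\infty}\sum_{k,l}|\Delta_{kl}(j\omega)|^2\,d\omega .$$ Perturbation. The measured transfer matrix is $G=(I+\Lambda)G_t$ (feedback uncertainty $G_t=(I+\Lambda)^{-1}G$), with $\Lambda=\epsilon\Lambda_0$ and $\epsilon=\max_{k,l}\|\Lambda(k,l)\|_\infty$. For fixed $G_t,\Lambda_0$, $\delta_i(\epsilon)$ denotes the value of $\delta_i$ for the data $G=(I+\epsilon\Lambda_0)G_t$. Algorithm $M_2$. Let $S^{p^2-p}$ be the fully-connected structure. For $j=p^2-p,\dots,1$: remove one link of $S^j$ at a time to get $j$ structures with $j-1$ links, compute $\delta$ for each, and let $S^{j-1}$ be the one with minimum $\delta$. ($S^0$ is the decoupled structure.) Let $\mathbb S=\{S^0,\dots,S^{p^2-p}\}$. The problem is solvable by Method $M_2$ if the true Boolean structure is in $\mathbb S$. Allowable structures are the Boolean structures containing at least all of the links of the true structure. Non-allowable structures are all other Boolean structures having no fewer links than the true structure.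
   Formalization: The off-diagonal part of the perturbation matrix is assumed to have finite Frobenius (L2) norm; otherwise, e.g. p=2, constant perturbation with nonzero off-diagonal entries and a one-link true structure, both one-link distances are infinite and the difference is undefined. *)

theory Defs
  imports
    "HOL-Analysis.Analysis"
    "HOL-Computational_Algebra.Computational_Algebra"
    "HOL-Computational_Algebra.Field_as_Ring"
begin

section \<open>Transfer matrices and dynamical structure functions\<close>

type_synonym tf = "real poly fract"

definition strictly_proper :: "tf \<Rightarrow> bool" where
  "strictly_proper f \<longleftrightarrow> (\<exists>a b. degree a < degree b \<and> f = Fract a b)"

text \<open>Evaluation uses the reduced fraction, so the junk value \<open>x / 0 = 0\<close> arises only at genuine
  poles, of which there are finitely many.\<close>

definition tf_eval :: "tf \<Rightarrow> complex \<Rightarrow> complex" where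
  "tf_eval f s =
     (case quot_of_fract f of (a, b) \<Rightarrow>
        poly (map_poly complex_of_real a) s / poly (map_poly complex_of_real b) s)"

definition freq_response :: "tf^'p^'p \<Rightarrow> real \<Rightarrow> complex^'p^'p" where
  "freq_response M \<omega> = (\<chi> k l. tf_eval (M $ k $ l) (\<i> * complex_of_real \<omega>))"

text \<open>The pair \<open>(Q, P)\<close> is a dynamical structure function, \<open>Y = Q Y + P U\<close>, of the transfer
  matrix \<open>G\<close>.\<close>

definition dsf :: "tf^'p^'p \<Rightarrow> tf^'p^'p \<Rightarrow> tf^'p^'p \<Rightarrow> bool" where
  "dsf Q P G \<longleftrightarrow>
     (\<forall>k l. strictly_proper (Q $ k $ l)) \<and>
     (\<forall>k l. strictly_proper (P $ k $ l)) \<and>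
     (\<forall>k. Q $ k $ k = 0) \<and>
     G = matrix_inv (mat 1 - Q) ** P"

definition diagonal_mat :: "'a::zero^'p^'p \<Rightarrow> bool" where
  "diagonal_mat M \<longleftrightarrow> (\<forall>k l. k \<noteq> l \<longrightarrow> M $ k $ l = 0)"


section \<open>Boolean structures\<close>

text \<open>A Boolean structure is represented by the set of its links, that is, of the off-diagonal
  positions \<open>(row, column)\<close> that are not constrained to be zero.\<close>

type_synonym 'p links = "('p \<times> 'p) set"

definition full_structure :: "'p links" where
  "full_structure = {(k, l). k \<noteq> l}"

definition bool_structure :: "'a::zero^'p^'p \<Rightarrow> 'p links" where
  "bool_structure Q = {(k, l). k \<noteq> l \<and> Q $ k $ l \<noteq> 0}"

definition allowable :: "'p links \<Rightarrow> 'p links \<Rightarrow> bool" where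
  "allowable T a \<longleftrightarrow> a \<subseteq> full_structure \<and> T \<subseteq> a"

definition non_allowable :: "'p links \<Rightarrow> 'p links \<Rightarrow> bool" where
  "non_allowable T n \<longleftrightarrow> n \<subseteq> full_structure \<and> \<not> allowable T n \<and> card T \<le> card n"


section \<open>Norms and the distance to a structure\<close>

text \<open>Frequency-dependent quantities are functions of \<open>\<omega>\<close>, where \<open>s = j \<omega>\<close>. Norms take values
  in the extended nonnegative reals, so divergent integrals are \<open>\<infinity>\<close>.\<close>

definition frob_norm_sq :: "(real \<Rightarrow> complex^'p^'p) \<Rightarrow> ennreal" where
  "frob_norm_sq D =
     ennreal (1 / (2 * pi)) *
       (\<integral>\<^sup>+ \<omega>. (\<Sum>k\<in>UNIV. \<Sum>l\<in>UNIV. ennreal ((cmod (D \<omega> $ k $ l))\<^sup>2)) \<partial>lborel)"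

definition linf_norm :: "(real \<Rightarrow> complex) \<Rightarrow> ennreal" where
  "linf_norm f = (SUP \<omega>. ennreal (cmod (f \<omega>)))"

text \<open>The columns of \<open>Gt\<close> tend to the coordinate directions at high frequency, so the distances to
  all structures are finite for small \<open>\<epsilon> > 0\<close> just when the off-diagonal part of \<open>\<Lambda>0\<close> is square
  integrable; bounded diagonal entries of \<open>\<Lambda>0\<close> can be absorbed by scaling.\<close>

definition off_diag :: "(real \<Rightarrow> complex^'p^'p) \<Rightarrow> real \<Rightarrow> complex^'p^'p" where
  "off_diag D = (\<lambda>\<omega>. \<chi> k l. if k = l then 0 else D \<omega> $ k $ l)"

text \<open>Measurability is what gives the integral in the Frobenius norm its meaning; diagonal entries
  are always free.\<close>

definition structured_mats :: "'p::finite links \<Rightarrow> (real \<Rightarrow> complex^'p^'p) set" where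
  "structured_mats i =
     {X \<in> borel_measurable borel. \<forall>\<omega> k l. k \<noteq> l \<and> (k, l) \<notin> i \<longrightarrow> X \<omega> $ k $ l = 0}"

definition delta_sq :: "(real \<Rightarrow> complex^'p^'p) \<Rightarrow> 'p::finite links \<Rightarrow> ennreal" where
  "delta_sq G i = (INF X \<in> structured_mats i. frob_norm_sq (\<lambda>\<omega>. G \<omega> ** X \<omega> - mat 1))"

definition perturbed :: "tf^'p^'p \<Rightarrow> (real \<Rightarrow> complex^'p^'p) \<Rightarrow> real \<Rightarrow> real \<Rightarrow> complex^'p^'p" where
  "perturbed Gt \<Lambda>0 \<epsilon> = (\<lambda>\<omega>. (mat 1 + \<epsilon> *\<^sub>R \<Lambda>0 \<omega>) ** freq_response Gt \<omega>)"


section \<open>Method \<open>M\<^sub>2\<close>\<close>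

definition link_removals :: "'p links \<Rightarrow> 'p links set" where
  "link_removals S = {S - {e} | e. e \<in> S}"

text \<open>Minimising \<open>\<delta>\<close> and minimising \<open>\<delta>\<^sup>2\<close> is the same thing, as \<open>\<delta> \<ge> 0\<close>. A run
  may resolve ties in any way; solvability is required for every such choice. Only the values
  \<open>S j\<close> with \<open>j \<le> p\<^sup>2 - p\<close> are relevant.\<close>

definition M2_run :: "(real \<Rightarrow> complex^'p^'p) \<Rightarrow> (nat \<Rightarrow> 'p::finite links) \<Rightarrow> bool" where
  "M2_run G S \<longleftrightarrow>
     S (CARD('p)\<^sup>2 - CARD('p)) = full_structure \<and>
     (\<forall>j\<in>{1..CARD('p)\<^sup>2 - CARD('p)}.
        is_arg_min (delta_sq G) (\<lambda>R. R \<in> link_removals (S j)) (S (j - 1)))"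

definition M2_solvable :: "(real \<Rightarrow> complex^'p^'p) \<Rightarrow> 'p::finite links \<Rightarrow> bool" where
  "M2_solvable G T \<longleftrightarrow>
     (\<forall>S. M2_run G S \<longrightarrow> T \<in> S ` {0..CARD('p)\<^sup>2 - CARD('p)})"

lemma card_full_structure:
  "card (full_structure :: 'p::finite links) = CARD('p)\<^sup>2 - CARD('p)"
proof -
  have "(full_structure :: 'p links) = UNIV - (\<lambda>k. (k, k)) ` UNIV"
    by (auto simp: full_structure_def)
  moreover have "card ((\<lambda>k::'p. (k, k)) ` UNIV) = CARD('p)"
    by (rule card_image) (auto simp: inj_on_def)
  ultimately show ?thesis
    using card_Diff_subset[of "range (\<lambda>k::'p. (k, k))" UNIV]
    by (simp add: power2_eq_square)
qed

text \<open>Runs exist, so solvability is never vacuous.\<close>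

lemma M2_run_exists: "\<exists>S. M2_run G (S :: nat \<Rightarrow> 'p::finite links)"
proof -
  define N where "N = CARD('p)\<^sup>2 - CARD('p)"
  define P where "P m R \<longleftrightarrow> (m \<le> N \<longrightarrow> card R = N - m) \<and> (m = 0 \<longrightarrow> R = full_structure)"
    for m and R :: "'p links"
  define step where "step m R R' \<longleftrightarrow>
      (m < N \<longrightarrow> is_arg_min (delta_sq G) (\<lambda>R'. R' \<in> link_removals R) R')"
    for m :: nat and R R' :: "'p links"
  have "\<exists>T. \<forall>m. P m (T m) \<and> step m (T m) (T (Suc m))"
  proof (rule dependent_nat_choice)
    show "\<exists>R. P 0 R"
      by (auto simp: P_def N_def card_full_structure)
  next
    fix R m assume PR: "P m R"
    show "\<exists>R'. P (Suc m) R' \<and> step m R R'"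
    proof (cases "m < N")
      case True
      with PR have c: "card R = N - m" by (simp add: P_def)
      with True have ne: "R \<noteq> {}" by auto
      have im: "link_removals R = (\<lambda>e. R - {e}) ` R"
        by (auto simp: link_removals_def)
      obtain R' where R': "is_arg_min (delta_sq G) (\<lambda>R'. R' \<in> link_removals R) R'"
        using ex_is_arg_min_if_finite[of "link_removals R" "delta_sq G"] ne im by auto
      then obtain e where "e \<in> R" "R' = R - {e}"
        by (auto simp: is_arg_min_def link_removals_def)
      with c True R' show ?thesis
        by (auto simp: P_def step_def)
    qed (auto simp: P_def step_def)
  qed
  then obtain T where T: "\<And>m. P m (T m)" "\<And>m. step m (T m) (T (Suc m))" by blast
  have "is_arg_min (delta_sq G) (\<lambda>R. R \<in> link_removals (T (N - j))) (T (N - (j - 1)))"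
    if "j \<in> {1..N}" for j
  proof -
    have "Suc (N - j) = N - (j - 1)" using that by auto
    with T(2)[of "N - j"] that show ?thesis by (auto simp: step_def)
  qed
  then have "M2_run G (\<lambda>j. T (N - j))"
    using T(1)[of 0] by (auto simp: M2_run_def P_def N_def)
  then show ?thesis by blast
qed

end

theory Submission
  imports Defs "HOL-Probability.Sinc_Integral"
begin

text \<open>
  At all but finitely many frequencies \<open>(I - Q) Gt = P\<close> holds with \<open>P\<close> diagonal and invertible.
  If \<open>T\<close> denotes the true structure, the matrix \<open>P\<^sup>-\<^sup>1 (I - Q)\<close>, with columns rescaled by
  \<open>1 / (1 + \<epsilon> \<Lambda>0 l l)\<close> to absorb the diagonal of \<open>\<Lambda>0\<close>, shows that \<open>\<delta>\<^sup>2\<close> is at most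
  \<open>4 \<epsilon>\<^sup>2\<close> times the squared norm of the off-diagonal part of \<open>\<Lambda>0\<close> for every structure that
  contains \<open>T\<close>. A structure that misses a link \<open>(k, l)\<close> of \<open>T\<close> has a residual that is bounded
  below in terms of \<open>Q k l\<close> on a set of frequencies of positive measure, uniformly for small
  \<open>\<epsilon>\<close>. Hence small perturbations separate the two kinds of structures, and \<open>M\<^sub>2\<close> never leaves
  the supersets of \<open>T\<close> before it reaches \<open>T\<close>. As \<open>Q\<close> is strictly proper, all the distances have
  a common finite bound \<open>C\<close>, so \<open>B n = C + 1\<close> satisfies \<open>0 < \<delta>\<^sub>n\<^sup>2 - \<delta>\<^sub>a\<^sup>2 < 2 B n\<close>, which is
  \<open>\<bar>F n a \<epsilon>\<bar> < B n\<close>.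
\<close>

(* The notation for power series coefficients makes every matrix entry M $ k $ l ambiguous. *)
no_notation fps_nth (infixl \<open>$\<close> 75)

section \<open>Evaluation of transfer functions on the imaginary axis\<close>

lemma map_poly_of_real_mult:
  "map_poly complex_of_real (p * q) = map_poly complex_of_real p * map_poly complex_of_real q"
  by (rule poly_eqI) (simp add: coeff_map_poly coeff_mult)

lemma map_poly_of_real_add:
  "map_poly complex_of_real (p + q) = map_poly complex_of_real p + map_poly complex_of_real q"
  by (rule poly_eqI) (simp add: coeff_map_poly)

lemma degree_map_poly_of_real: "degree (map_poly complex_of_real p) = degree p"
  by (rule degree_map_poly) auto

lemma map_poly_of_real_eq_0_iff: "map_poly complex_of_real p = 0 \<longleftrightarrow> p = 0"
  by (rule map_poly_eq_0_iff) auto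

abbreviation poly_iaxis :: "real poly \<Rightarrow> real \<Rightarrow> complex" where
  "poly_iaxis p \<omega> \<equiv> poly (map_poly complex_of_real p) (\<i> * complex_of_real \<omega>)"

text \<open>Coprimality makes the reduced denominator \<open>b'\<close> a divisor of
  \<open>b\<close>, so \<open>b'\<close> does not vanish at \<open>s\<close> either, and
  \<open>a' * b = a * b'\<close> can be evaluated and divided out.\<close>

lemma tf_eval_Fract:
  assumes "poly (map_poly complex_of_real b) s \<noteq> 0"
  shows "tf_eval (Fract a b) s
    = poly (map_poly complex_of_real a) s / poly (map_poly complex_of_real b) s"
proof -
  obtain a' b' where q: "quot_of_fract (Fract a b) = (a', b')" by fastforce
  have b: "b \<noteq> 0" using assms by auto
  have b': "b' \<noteq> 0" using snd_quot_of_fract_nonzero[of "Fract a b"] q by simp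
  have "Fract a' b' = Fract a b" using Fract_quot_of_fract[of "Fract a b"] q by simp
  then have e: "a' * b = a * b'" using b b' by (simp add: eq_fract)
  have "coprime a' b'" using coprime_quot_of_fract[of "Fract a b"] q by simp
  moreover have "b' dvd a' * b" using e by simp
  ultimately have "b' dvd b" by (metis coprime_commute coprime_dvd_mult_right_iff)
  then obtain c where "b = b' * c" by blast
  then have nz: "poly (map_poly complex_of_real b') s \<noteq> 0"
    using assms by (auto simp: map_poly_of_real_mult)
  have "poly (map_poly complex_of_real (a' * b)) s = poly (map_poly complex_of_real (a * b')) s"
    by (simp only: e)
  then show ?thesis
    using assms nz by (simp add: tf_eval_def q map_poly_of_real_mult field_simps)
qed

lemma eventually_poly_iaxis_nonzero:
  assumes "b \<noteq> 0"
  shows "\<forall>\<^sub>F \<omega> in cofinite. poly_iaxis b \<omega> \<noteq> 0"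
proof -
  have "finite {z. poly (map_poly complex_of_real b) z = 0}"
    by (rule poly_roots_finite) (simp add: map_poly_of_real_eq_0_iff assms)
  then have "finite ((\<lambda>\<omega>. \<i> * complex_of_real \<omega>) -` {z. poly (map_poly complex_of_real b) z = 0})"
    by (rule finite_vimageI) (auto simp: inj_on_def)
  then show ?thesis by (simp add: eventually_cofinite vimage_def)
qed

lemma eventually_tf_eval_Fract:
  assumes "b \<noteq> 0"
  shows "\<forall>\<^sub>F \<omega> in cofinite.
    tf_eval (Fract a b) (\<i> * complex_of_real \<omega>) = poly_iaxis a \<omega> / poly_iaxis b \<omega>"
  using eventually_poly_iaxis_nonzero[OF assms] by eventually_elim (rule tf_eval_Fract)

text \<open>Because of \<open>x / 0 = 0\<close>, evaluation is not multiplicative where a pole of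
  one factor cancels against a zero of the other, as for \<open>s\<close> and \<open>1/s\<close> at
  0. Such frequencies are roots of the denominators, hence finitely many. Identities along
  \<open>cofinite\<close> suffice both for high-frequency limits and for integrands.\<close>

lemma eventually_tf_eval_mult:
  "\<forall>\<^sub>F \<omega> in cofinite. tf_eval (f * g) (\<i> * complex_of_real \<omega>) =
     tf_eval f (\<i> * complex_of_real \<omega>) * tf_eval g (\<i> * complex_of_real \<omega>)"
proof -
  obtain a b where f: "f = Fract a b" "b \<noteq> 0" by (cases f)
  obtain c d where g: "g = Fract c d" "d \<noteq> 0" by (cases g)
  have fg: "f * g = Fract (a * c) (b * d)" "b * d \<noteq> 0" using f g by auto
  show ?thesis
    using eventually_tf_eval_Fract[OF fg(2), of "a * c"] eventually_tf_eval_Fract[OF f(2), of a]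
      eventually_tf_eval_Fract[OF g(2), of c]
    unfolding fg(1) unfolding f g by eventually_elim (simp add: map_poly_of_real_mult)
qed

lemma eventually_tf_eval_add:
  "\<forall>\<^sub>F \<omega> in cofinite. tf_eval (f + g) (\<i> * complex_of_real \<omega>) =
     tf_eval f (\<i> * complex_of_real \<omega>) + tf_eval g (\<i> * complex_of_real \<omega>)"
proof -
  obtain a b where f: "f = Fract a b" "b \<noteq> 0" by (cases f)
  obtain c d where g: "g = Fract c d" "d \<noteq> 0" by (cases g)
  have fg: "f + g = Fract (a * d + c * b) (b * d)" "b * d \<noteq> 0" using f g by auto
  show ?thesis
    using eventually_tf_eval_Fract[OF fg(2), of "a * d + c * b"]
      eventually_tf_eval_Fract[OF f(2), of a] eventually_tf_eval_Fract[OF g(2), of c]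
      eventually_poly_iaxis_nonzero[OF f(2)] eventually_poly_iaxis_nonzero[OF g(2)]
    unfolding fg(1) unfolding f g
    by eventually_elim (simp add: map_poly_of_real_mult map_poly_of_real_add add_frac_eq)
qed

lemma tf_eval_0 [simp]: "tf_eval 0 s = 0"
  by (simp add: tf_eval_def)

lemma tf_eval_1 [simp]: "tf_eval 1 s = 1"
  by (simp add: tf_eval_def)

text \<open>The product of the values of \<open>f\<close> and \<open>inverse f\<close> is 1 at
  almost all frequencies, so neither factor can vanish there.\<close>

lemma eventually_tf_eval_nonzero:
  assumes "f \<noteq> 0"
  shows "\<forall>\<^sub>F \<omega> in cofinite. tf_eval f (\<i> * complex_of_real \<omega>) \<noteq> 0"
  using eventually_tf_eval_mult[of f "inverse f"]
  by eventually_elim (use assms in auto)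

lemma eventually_tf_eval_diff:
  "\<forall>\<^sub>F \<omega> in cofinite. tf_eval (f - g) (\<i> * complex_of_real \<omega>) =
     tf_eval f (\<i> * complex_of_real \<omega>) - tf_eval g (\<i> * complex_of_real \<omega>)"
  using eventually_tf_eval_add[of "f - g" g] by eventually_elim simp

lemma eventually_tf_eval_sum:
  assumes "finite A"
  shows "\<forall>\<^sub>F \<omega> in cofinite. tf_eval (\<Sum>i\<in>A. f i) (\<i> * complex_of_real \<omega>) =
     (\<Sum>i\<in>A. tf_eval (f i) (\<i> * complex_of_real \<omega>))"
  using assms
proof (induction A rule: finite_induct)
  case (insert x A)
  then show ?case
    using eventually_tf_eval_add[of "f x" "sum f A"] by (auto elim: eventually_elim2)
qed simp

lemma eventually_freq_response_mult:
  "\<forall>\<^sub>F \<omega> in cofinite.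
     freq_response (M ** N) \<omega> = freq_response M \<omega> ** freq_response N \<omega>"
  for M N :: "tf^'p::finite^'p"
proof -
  have "\<forall>\<^sub>F \<omega> in cofinite. \<forall>k\<in>UNIV. \<forall>l\<in>UNIV.
      freq_response (M ** N) \<omega> $ k $ l = (freq_response M \<omega> ** freq_response N \<omega>) $ k $ l"
  proof (intro eventually_ball_finite ballI finite)
    fix k l
    have "\<forall>\<^sub>F \<omega> in cofinite. \<forall>j\<in>UNIV. tf_eval (M $ k $ j * N $ j $ l) (\<i> * complex_of_real \<omega>) =
        tf_eval (M $ k $ j) (\<i> * complex_of_real \<omega>) * tf_eval (N $ j $ l) (\<i> * complex_of_real \<omega>)"
      by (intro eventually_ball_finite ballI finite eventually_tf_eval_mult)
    with eventually_tf_eval_sum[OF finite_class.finite_UNIV, of "\<lambda>j. M $ k $ j * N $ j $ l"]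
    show "\<forall>\<^sub>F \<omega> in cofinite. freq_response (M ** N) \<omega> $ k $ l =
        (freq_response M \<omega> ** freq_response N \<omega>) $ k $ l"
      by eventually_elim (simp add: freq_response_def matrix_matrix_mult_def)
  qed
  then show ?thesis by eventually_elim (simp add: vec_eq_iff)
qed

lemma eventually_freq_response_diff:
  "\<forall>\<^sub>F \<omega> in cofinite.
     freq_response (M - N) \<omega> = freq_response M \<omega> - freq_response N \<omega>"
  for M N :: "tf^'p::finite^'p"
proof -
  have "\<forall>\<^sub>F \<omega> in cofinite. \<forall>k\<in>UNIV. \<forall>l\<in>UNIV.
      freq_response (M - N) \<omega> $ k $ l = (freq_response M \<omega> - freq_response N \<omega>) $ k $ l"
    unfolding freq_response_def
    by (intro eventually_ball_finite ballI finite) (simp add: eventually_tf_eval_diff)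
  then show ?thesis by eventually_elim (simp add: vec_eq_iff)
qed

lemma freq_response_mat_1 [simp]: "freq_response (mat 1) \<omega> = mat 1"
  by (simp add: freq_response_def mat_def vec_eq_iff)

section \<open>Decay of strictly proper functions at high frequency\<close>

lemma at_infinity_le_cofinite: "at_infinity \<le> (cofinite :: 'a::{real_normed_vector, perfect_space} filter)"
proof (rule filter_leI)
  fix P :: "'a \<Rightarrow> bool" assume "eventually P cofinite"
  then have "\<forall>\<^sub>F x in at_infinity. \<forall>y\<in>{y. \<not> P y}. x \<noteq> y"
    by (intro eventually_ball_finite ballI eventually_not_equal_at_infinity)
      (simp add: eventually_cofinite)
  then show "eventually P at_infinity" by eventually_elim blast
qed

text \<open>Strict properness leaves room for one more factor \<open>s\<close>: the function
  \<open>s f(s)\<close> is still proper, so it has a finite limit \<open>c\<close> at infinity and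
  is eventually bounded by \<open>1 + cmod c\<close>.\<close>

lemma strictly_proper_bound:
  assumes "strictly_proper f"
  shows "\<exists>K. \<forall>\<^sub>F \<omega> in at_infinity. cmod (tf_eval f (\<i> * complex_of_real \<omega>)) \<le> K / \<bar>\<omega>\<bar>"
proof -
  obtain a b where ab: "degree a < degree b" "f = Fract a b"
    using assms by (auto simp: strictly_proper_def)
  then have b: "b \<noteq> 0" by auto
  \<comment> \<open>\<open>pCons 0 a\<close> is the polynomial \<open>s * a(s)\<close>.\<close>
  define A where "A = map_poly complex_of_real (pCons 0 a)"
  define B where "B = map_poly complex_of_real b"
  have dA: "degree A \<le> degree B" using ab by (simp add: A_def B_def degree_map_poly_of_real)
  have B: "B \<noteq> 0" using b by (simp add: B_def map_poly_of_real_eq_0_iff)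
  have "\<exists>c. ((\<lambda>z. poly A z / poly B z) \<longlongrightarrow> c) at_infinity"
  proof (cases "degree A = degree B")
    case False
    with dA poly_divide_tendsto_0_at_infinity[of A B] show ?thesis by auto
  next
    case True
    have "((\<lambda>z. (poly A z / z ^ degree A) / (poly B z / z ^ degree B))
        \<longlongrightarrow> lead_coeff A / lead_coeff B) at_infinity"
      by (intro tendsto_divide poly_divide_tendsto_aux) (use B in auto)
    moreover have "\<forall>\<^sub>F z in at_infinity.
        (poly A z / z ^ degree A) / (poly B z / z ^ degree B) = poly A z / poly B z"
      using eventually_not_equal_at_infinity[of 0] by eventually_elim (simp add: True)
    ultimately show ?thesis by (auto dest: Lim_transform_eventually)
  qed
  then obtain c where "((\<lambda>z. poly A z / poly B z) \<longlongrightarrow> c) at_infinity" by blast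
  moreover have "filterlim (\<lambda>\<omega>. \<i> * complex_of_real \<omega>) at_infinity at_infinity"
    by (rule filterlim_at_infinity_conv_norm_at_top[THEN iffD2])
      (use filterlim_norm_at_top[where 'a = real] in \<open>simp add: norm_mult real_norm_def[abs_def]\<close>)
  ultimately have "((\<lambda>\<omega>. poly A (\<i> * complex_of_real \<omega>) / poly B (\<i> * complex_of_real \<omega>)) \<longlongrightarrow> c) at_infinity"
    by (rule filterlim_compose)
  then have "\<forall>\<^sub>F \<omega> in at_infinity.
      dist (poly A (\<i> * complex_of_real \<omega>) / poly B (\<i> * complex_of_real \<omega>)) c < 1"
    by (rule tendstoD) simp
  moreover have "\<forall>\<^sub>F \<omega> in at_infinity. poly_iaxis b \<omega> \<noteq> 0"
    using eventually_poly_iaxis_nonzero[OF b]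
    by (rule filter_leD[OF at_infinity_le_cofinite])
  moreover have "\<forall>\<^sub>F \<omega> in at_infinity. (\<omega>::real) \<noteq> 0"
    by (rule eventually_not_equal_at_infinity)
  ultimately have "\<forall>\<^sub>F \<omega> in at_infinity.
    cmod (tf_eval f (\<i> * complex_of_real \<omega>)) \<le> (1 + cmod c) / \<bar>\<omega>\<bar>"
  proof eventually_elim
    case (elim \<omega>)
    define s where "s = \<i> * complex_of_real \<omega>"
    have s: "cmod s = \<bar>\<omega>\<bar>" "s \<noteq> 0" using elim(3) by (auto simp: s_def norm_mult)
    have e: "tf_eval f s = (poly A s / poly B s) / s"
      using elim(2) s(2) tf_eval_Fract[of b s a]
      by (simp add: ab(2) A_def B_def s_def map_poly_pCons)
    have "cmod (poly A s / poly B s) \<le> 1 + cmod c"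
      using elim(1) norm_triangle_sub[of "poly A s / poly B s" c]
      by (simp add: s_def dist_norm)
    moreover have "cmod (tf_eval f s) = cmod (poly A s / poly B s) / \<bar>\<omega>\<bar>"
      by (simp only: e norm_divide[of _ s] s)
    ultimately show ?case
      by (simp add: divide_right_mono flip: s_def)
  qed
  then show ?thesis by blast
qed

section \<open>Dynamical structure functions at real frequencies\<close>

text \<open>In the 1-norm of vectors, a matrix with entries of modulus at most \<eta> has operator
  norm at most \<open>CARD('p) * \<eta>\<close>. This is what makes \<open>Q\<close> a contraction
  at high frequency.\<close>

lemma sum_cmod_mult_le:
  fixes q :: "complex^'p::finite^'p" and h :: "'p \<Rightarrow> complex" and \<eta> :: real
  assumes "\<And>k j. cmod (q $ k $ j) \<le> \<eta>"
  shows "cmod (\<Sum>j\<in>UNIV. q $ k $ j * h j) \<le> \<eta> * (\<Sum>j\<in>UNIV. cmod (h j))"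
    and "(\<Sum>k\<in>UNIV. cmod (\<Sum>j\<in>UNIV. q $ k $ j * h j)) \<le> CARD('p) * \<eta> * (\<Sum>j\<in>UNIV. cmod (h j))"
proof -
  show *: "cmod (\<Sum>j\<in>UNIV. q $ k $ j * h j) \<le> \<eta> * (\<Sum>j\<in>UNIV. cmod (h j))" for k
    unfolding sum_distrib_left
    by (intro sum_norm_le) (simp add: norm_mult assms mult_right_mono)
  show "(\<Sum>k\<in>UNIV. cmod (\<Sum>j\<in>UNIV. q $ k $ j * h j)) \<le> CARD('p) * \<eta> * (\<Sum>j\<in>UNIV. cmod (h j))"
    using sum_bounded_above[where A = UNIV, OF *] by (simp add: mult.assoc)
qed

lemma strictly_proper_matrix_bound:
  fixes Q :: "tf^'p::finite^'p"
  assumes "\<And>k l. strictly_proper (Q $ k $ l)"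
  obtains K where "K \<ge> 0"
    "\<forall>\<^sub>F \<omega> in at_infinity. \<forall>k l. cmod (freq_response Q \<omega> $ k $ l) \<le> K / \<bar>\<omega>\<bar>"
proof -
  obtain c where c: "\<And>k l. \<forall>\<^sub>F \<omega> in at_infinity.
      cmod (tf_eval (Q $ k $ l) (\<i> * complex_of_real \<omega>)) \<le> c k l / \<bar>\<omega>\<bar>"
    using strictly_proper_bound[OF assms] by metis
  \<comment> \<open>The sum of the absolute values is one nonnegative constant that dominates every
    \<open>c k l\<close>.\<close>
  define K where "K = (\<Sum>k\<in>UNIV. \<Sum>l\<in>UNIV. \<bar>c k l\<bar>)"
  have cK: "c k l \<le> K" for k l
  proof -
    have "\<bar>c k l\<bar> \<le> (\<Sum>l\<in>UNIV. \<bar>c k l\<bar>)" by (rule member_le_sum) auto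
    also have "\<dots> \<le> K" unfolding K_def
      by (rule member_le_sum[where f = "\<lambda>k. \<Sum>l\<in>UNIV. \<bar>c k l\<bar>"]) (auto intro: sum_nonneg)
    finally show ?thesis by simp
  qed
  have "\<forall>\<^sub>F \<omega> in at_infinity. \<forall>k\<in>UNIV. \<forall>l\<in>UNIV.
      cmod (tf_eval (Q $ k $ l) (\<i> * complex_of_real \<omega>)) \<le> c k l / \<bar>\<omega>\<bar>"
    by (intro eventually_ball_finite ballI finite c)
  then have "\<forall>\<^sub>F \<omega> in at_infinity. \<forall>k l. cmod (freq_response Q \<omega> $ k $ l) \<le> K / \<bar>\<omega>\<bar>"
  proof eventually_elim
    case (elim \<omega>)
    have "c k l / \<bar>\<omega>\<bar> \<le> K / \<bar>\<omega>\<bar>" for k l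
      using cK by (rule divide_right_mono) simp
    with elim show ?case
      unfolding freq_response_def vec_lambda_beta by (blast intro: order_trans)
  qed
  moreover have "K \<ge> 0" by (auto simp: K_def intro!: sum_nonneg)
  ultimately show ?thesis using that by blast
qed

text \<open>A kernel vector \<open>x = Q x\<close> evaluates to \<open>0\<close> at all high frequencies, where \<open>Q\<close> is a
  contraction, and a nonzero rational function has only finitely many zeros.\<close>

lemma invertible_one_minus_strictly_proper:
  fixes Q :: "tf^'p::finite^'p"
  assumes "\<And>k l. strictly_proper (Q $ k $ l)"
  shows "invertible (mat 1 - Q)"
proof -
  obtain K where "K \<ge> 0"
    and K: "\<forall>\<^sub>F \<omega> in at_infinity. \<forall>k l. cmod (freq_response Q \<omega> $ k $ l) \<le> K / \<bar>\<omega>\<bar>"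
    using strictly_proper_matrix_bound[OF assms] by blast
  have "x = 0" if x: "(mat 1 - Q) *v x = 0" for x
  proof (rule ccontr)
    assume "x \<noteq> 0"
    then obtain k0 where k0: "x $ k0 \<noteq> 0" by (auto simp: vec_eq_iff)
    have "x = Q *v x"
      using x by (simp only: matrix_vector_mult_diff_rdistrib matrix_vector_mul_lid right_minus_eq)
    then have "x $ k = (Q *v x) $ k" for k
      by (rule arg_cong)
    then have fix_eq: "x $ k = (\<Sum>j\<in>UNIV. Q $ k $ j * x $ j)" for k
      unfolding matrix_vector_mult_def vec_lambda_beta .
    have "\<forall>\<^sub>F \<omega> in cofinite. \<forall>k\<in>UNIV. tf_eval (x $ k) (\<i> * complex_of_real \<omega>) =
        (\<Sum>j\<in>UNIV. freq_response Q \<omega> $ k $ j * tf_eval (x $ j) (\<i> * complex_of_real \<omega>))"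
    proof (intro eventually_ball_finite ballI finite)
      fix k
      have "\<forall>\<^sub>F \<omega> in cofinite. \<forall>j\<in>UNIV. tf_eval (Q $ k $ j * x $ j) (\<i> * complex_of_real \<omega>) =
          tf_eval (Q $ k $ j) (\<i> * complex_of_real \<omega>) * tf_eval (x $ j) (\<i> * complex_of_real \<omega>)"
        by (intro eventually_ball_finite ballI finite eventually_tf_eval_mult)
      with eventually_tf_eval_sum[OF finite_class.finite_UNIV, of "\<lambda>j. Q $ k $ j * x $ j"]
      show "\<forall>\<^sub>F \<omega> in cofinite. tf_eval (x $ k) (\<i> * complex_of_real \<omega>) =
          (\<Sum>j\<in>UNIV. freq_response Q \<omega> $ k $ j * tf_eval (x $ j) (\<i> * complex_of_real \<omega>))"
        unfolding fix_eq[of k] freq_response_def vec_lambda_beta by eventually_elim simp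
    qed
    then have "\<forall>\<^sub>F \<omega> in at_infinity. \<forall>k\<in>UNIV. tf_eval (x $ k) (\<i> * complex_of_real \<omega>) =
        (\<Sum>j\<in>UNIV. freq_response Q \<omega> $ k $ j * tf_eval (x $ j) (\<i> * complex_of_real \<omega>))"
      by (rule filter_leD[OF at_infinity_le_cofinite])
    moreover have "\<forall>\<^sub>F \<omega> in at_infinity. tf_eval (x $ k0) (\<i> * complex_of_real \<omega>) \<noteq> 0"
      by (rule filter_leD[OF at_infinity_le_cofinite eventually_tf_eval_nonzero[OF k0]])
    \<comment> \<open>Beyond this threshold \<open>CARD('p) * (K / \<bar>\<omega>\<bar>)\<close> is
      at most 1/2; the summand 1 keeps \<omega> away from 0.\<close>
    moreover have "\<forall>\<^sub>F \<omega> in at_infinity. 2 * real CARD('p) * \<bar>K\<bar> + 1 \<le> norm (\<omega> :: real)"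
      unfolding eventually_at_infinity by blast
    ultimately have "\<forall>\<^sub>F \<omega> :: real in at_infinity. False"
      using K
    proof eventually_elim
      case (elim \<omega>)
      define y where "y k = tf_eval (x $ k) (\<i> * complex_of_real \<omega>)" for k
      define S where "S = (\<Sum>j\<in>UNIV. cmod (y j))"
      have S: "S \<ge> cmod (y k0)" unfolding S_def by (rule member_le_sum) auto
      have y: "y k = (\<Sum>j\<in>UNIV. freq_response Q \<omega> $ k $ j * y j)" for k
        using elim(1) unfolding y_def by blast
      \<comment> \<open>The 1-norm of the fixed point equation gives \<open>S \<le> S / 2\<close>,
        so the kernel vector evaluates to 0.\<close>
      have "S = (\<Sum>k\<in>UNIV. cmod (\<Sum>j\<in>UNIV. freq_response Q \<omega> $ k $ j * y j))"
        by (simp only: S_def flip: y)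
      also have "\<dots> \<le> CARD('p) * (K / \<bar>\<omega>\<bar>) * S"
        unfolding S_def by (rule sum_cmod_mult_le(2)) (use elim(4) in blast)
      also have "CARD('p) * (K / \<bar>\<omega>\<bar>) \<le> 1/2"
      proof -
        have "2 * real CARD('p) * K \<le> 2 * real CARD('p) * \<bar>K\<bar>" by (intro mult_left_mono) auto
        also have "\<dots> \<le> \<bar>\<omega>\<bar>" using elim(3) by simp
        finally have "2 * real CARD('p) * K \<le> \<bar>\<omega>\<bar>" .
        moreover have "0 \<le> 2 * real CARD('p) * \<bar>K\<bar>" by simp
        then have "\<bar>\<omega>\<bar> > 0" using elim(3) unfolding real_norm_def by linarith
        ultimately show ?thesis by (simp add: field_simps)
      qed
      then have "CARD('p) * (K / \<bar>\<omega>\<bar>) * S \<le> 1/2 * S"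
        by (rule mult_right_mono) (simp add: S_def sum_nonneg)
      finally have "S \<le> 0" by simp
      with S have "cmod (y k0) \<le> 0" by linarith
      then have "y k0 = 0" by simp
      with elim(2) show False by (simp add: y_def)
    qed
    then show False by (simp add: trivial_limit_at_infinity)
  qed
  then show ?thesis
    unfolding invertible_left_inverse matrix_left_invertible_ker by blast
qed

text \<open>\<open>matrix_inv\<close> is a choice that is meaningful only for invertible arguments;
  strict properness of \<open>Q\<close> supplies the invertibility, and then the equation in
  \<open>dsf\<close> can be multiplied out.\<close>

lemma dsf_matrix_eq:
  assumes "dsf Q P (Gt :: tf^'p::finite^'p)"
  shows "(mat 1 - Q) ** Gt = P"
proof -
  have "invertible (mat 1 - Q)"
    using assms by (intro invertible_one_minus_strictly_proper) (auto simp: dsf_def)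
  then have inv: "(mat 1 - Q) ** matrix_inv (mat 1 - Q) = mat 1"
    unfolding invertible_def matrix_inv_def by (rule someI2_ex) (rule conjunct1)
  have "Gt = matrix_inv (mat 1 - Q) ** P"
    using assms by (simp only: dsf_def)
  then show ?thesis
    by (simp only: matrix_mul_assoc inv matrix_mul_lid)
qed

lemma invertible_if_full_rank:
  fixes A :: "'a::field^'p::finite^'p"
  assumes "rank A = CARD('p)"
  shows "invertible A"
proof -
  have "vec.span (rows A) = UNIV"
    by (rule vec.dim_eq_full[THEN iffD1])
      (simp only: vec.dimension_def card_cart_basis assms[unfolded row_rank_def_gen])
  then show ?thesis
    unfolding invertible_left_inverse matrix_left_invertible_span_rows_gen .
qed

text \<open>Determinants of \<open>(I - Q) Gt = P\<close>: both factors on the left are invertible,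
  the second by full rank, and the determinant of the diagonal \<open>P\<close> is the product of
  its diagonal entries.\<close>

lemma dsf_diagonal_nonzero:
  assumes "dsf Q P (Gt :: tf^'p::finite^'p)" "diagonal_mat P" "rank Gt = CARD('p)"
  shows "P $ k $ k \<noteq> 0"
proof -
  have "invertible (mat 1 - Q)"
    using assms by (intro invertible_one_minus_strictly_proper) (auto simp: dsf_def)
  then have "det (mat 1 - Q) * det Gt \<noteq> 0"
    using invertible_if_full_rank[OF assms(3)] by (simp add: invertible_det_nz)
  then have "det P \<noteq> 0"
    by (simp only: det_mul not_False_eq_True flip: dsf_matrix_eq[OF assms(1)])
  moreover have "det P = (\<Prod>i\<in>UNIV. P $ i $ i)"
    by (rule det_diagonal) (use assms(2) in \<open>auto simp: diagonal_mat_def\<close>)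
  ultimately show ?thesis by simp
qed

text \<open>This transfers the algebra of rational functions to complex matrices at single
  frequencies. It provides the premises \<open>eq\<close> and \<open>nz\<close> of the residual
  bounds, off a finite and therefore null set.\<close>

lemma dsf_frequency:
  assumes "dsf Q P (Gt :: tf^'p::finite^'p)" "diagonal_mat P" "rank Gt = CARD('p)"
  shows "\<forall>\<^sub>F \<omega> in cofinite.
    (mat 1 - freq_response Q \<omega>) ** freq_response Gt \<omega> = freq_response P \<omega> \<and>
    (\<forall>k. freq_response P \<omega> $ k $ k \<noteq> 0)"
proof -
  have "\<forall>\<^sub>F \<omega> in cofinite. \<forall>k\<in>UNIV. freq_response P \<omega> $ k $ k \<noteq> 0"
    unfolding freq_response_def
    by (intro eventually_ball_finite ballI finite)
      (simp add: eventually_tf_eval_nonzero dsf_diagonal_nonzero[OF assms])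
  with eventually_freq_response_mult[of "mat 1 - Q" Gt] eventually_freq_response_diff[of "mat 1" Q]
  show ?thesis
    by eventually_elim (simp add: dsf_matrix_eq[OF assms(1)])
qed

section \<open>Residuals at a fixed frequency\<close>

lemma matrix_diff_ldistrib: "A ** (B - C) = A ** B - A ** C"
  for A :: "'a::ring_1^'n::finite^'m" and B C :: "'a^'l^'n"
  by (simp add: vec_eq_iff matrix_matrix_mult_def right_diff_distrib sum_subtractf)

lemma matrix_diff_rdistrib: "(A - B) ** C = A ** C - B ** C"
  for A B :: "'a::ring_1^'n::finite^'m" and C :: "'a^'l^'n"
  by (simp add: vec_eq_iff matrix_matrix_mult_def left_diff_distrib sum_subtractf)

lemma matrix_add_rdistrib: "(A + B) ** C = A ** C + B ** C"
  for A B :: "'a::ring_1^'n::finite^'m" and C :: "'a^'l^'n"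
  by (simp add: vec_eq_iff matrix_matrix_mult_def distrib_right sum.distrib)

text \<open>Let \<open>w\<close> be column \<open>l\<close> of \<open>g X - I\<close>. Entry
  \<open>(k, l)\<close> of \<open>(I - q) (g X - I) = pm X - (I - q)\<close> is
  \<open>q k l\<close>, since \<open>pm\<close> is diagonal and \<open>X k l = 0\<close>. As the
  entries of row \<open>k\<close> of \<open>I - q\<close> are at most \<open>1 + s\<close>, the
  1-norm \<open>W\<close> of \<open>w\<close> is at least \<open>d\<close>. The perturbation costs
  at most \<open>\<epsilon> CARD('p) (W + 1) \<le> W/2 + d/4\<close>, so the perturbed column keeps
  1-norm at least \<open>d/4\<close>.\<close>

lemma residual_lower_bound:
  fixes q g pm L X :: "complex^'p::finite^'p" and \<epsilon> d :: real
  assumes eq: "(mat 1 - q) ** g = pm"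
    and diag: "\<And>i j. i \<noteq> j \<Longrightarrow> pm $ i $ j = 0"
    and X: "X $ k $ l = 0" and kl: "k \<noteq> l"
    and L: "\<And>i j. cmod (L $ i $ j) \<le> 1"
    and \<epsilon>: "0 \<le> \<epsilon>" "\<epsilon> * CARD('p) \<le> 1/2" "\<epsilon> * CARD('p) \<le> d / 4"
    and d: "d * (1 + (\<Sum>m\<in>UNIV. cmod (q $ k $ m))) \<le> cmod (q $ k $ l)"
  shows "(d / (4 * CARD('p)))\<^sup>2 \<le>
    (\<Sum>i\<in>UNIV. \<Sum>j\<in>UNIV. (cmod (((mat 1 + \<epsilon> *\<^sub>R L) ** g ** X - mat 1) $ i $ j))\<^sup>2)"
proof -
  define w where "w m = (g ** X - mat 1) $ m $ l" for m
  define v where "v m = ((mat 1 + \<epsilon> *\<^sub>R L) ** g ** X - mat 1) $ m $ l" for m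
  define W where "W = (\<Sum>m\<in>UNIV. cmod (w m))"
  define V where "V = (\<Sum>m\<in>UNIV. cmod (v m))"
  define s where "s = (\<Sum>m\<in>UNIV. cmod (q $ k $ m))"
  have s: "s \<ge> 0" by (simp add: s_def sum_nonneg)
  have W0: "W \<ge> 0" by (simp add: W_def sum_nonneg)
  have d0: "d \<ge> 0"
    using mult_nonneg_nonneg[OF \<epsilon>(1) of_nat_0_le_iff[of "CARD('p)"]] \<epsilon>(3) by linarith
  have "((mat 1 - q) ** (g ** X - mat 1)) $ k $ l = (pm ** X - (mat 1 - q)) $ k $ l"
    by (simp add: matrix_diff_ldistrib matrix_mul_assoc eq del: vector_minus_component)
  also have "(pm ** X) $ k $ l = 0"
  proof -
    have "pm $ k $ j * X $ j $ l = 0" for j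
      using diag X by (cases "j = k") auto
    then show ?thesis
      unfolding matrix_matrix_mult_def vec_lambda_beta by (intro sum.neutral) blast
  qed
  then have "(pm ** X - (mat 1 - q)) $ k $ l = q $ k $ l"
    using X kl by (simp add: mat_def)
  also have "((mat 1 - q) ** (g ** X - mat 1)) $ k $ l = (\<Sum>m\<in>UNIV. (mat 1 - q) $ k $ m * w m)"
    by (simp add: matrix_matrix_mult_def w_def)
  finally have "cmod (q $ k $ l) = cmod (\<Sum>m\<in>UNIV. (mat 1 - q) $ k $ m * w m)" by simp
  also have "\<dots> \<le> (\<Sum>m\<in>UNIV. (1 + s) * cmod (w m))"
  proof (rule sum_norm_le)
    fix m
    have "cmod ((mat 1 - q) $ k $ m) \<le> cmod (mat 1 $ k $ m) + cmod (q $ k $ m)"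
      by (simp add: norm_triangle_ineq4)
    also have "\<dots> \<le> 1 + s"
      unfolding s_def by (intro add_mono member_le_sum) (auto simp: mat_def)
    finally show "norm ((mat 1 - q) $ k $ m * w m) \<le> (1 + s) * cmod (w m)"
      unfolding norm_mult by (rule mult_right_mono) simp
  qed
  also have "\<dots> = (1 + s) * W" by (simp add: W_def sum_distrib_left)
  finally have "d * (1 + s) \<le> W * (1 + s)" using d by (simp add: s_def mult.commute)
  then have dW: "d \<le> W" using s by (simp add: mult_le_cancel_right)

  \<comment> \<open>Column \<open>l\<close> of \<open>(I + \<epsilon> L) g X - I = (g X - I) +
    \<epsilon> (L (g X - I) + L)\<close>: the perturbation acts on the residual itself, so no bound
    on \<open>g\<close> or \<open>X\<close> enters.\<close>
  have vw: "w m = v m - \<epsilon> *\<^sub>R ((\<Sum>j\<in>UNIV. L $ m $ j * w j) + L $ m $ l)" for m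
  proof -
    have "(mat 1 + \<epsilon> *\<^sub>R L) ** g ** X - mat 1
        = (g ** X - mat 1) + \<epsilon> *\<^sub>R (L ** (g ** X - mat 1) + L)"
      by (simp add: matrix_add_rdistrib matrix_diff_ldistrib matrix_mul_assoc algebra_simps flip: scalar_matrix_assoc)
    then have "v m = ((g ** X - mat 1) + \<epsilon> *\<^sub>R (L ** (g ** X - mat 1) + L)) $ m $ l"
      by (simp add: v_def)
    moreover have "(L ** (g ** X - mat 1)) $ m $ l = (\<Sum>j\<in>UNIV. L $ m $ j * w j)"
      by (simp add: matrix_matrix_mult_def w_def)
    ultimately show ?thesis by (simp add: w_def)
  qed
  have "W \<le> (\<Sum>m\<in>UNIV. cmod (v m) + \<epsilon> * (W + 1))"
    unfolding W_def
  proof (rule sum_mono)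
    fix m
    have "cmod (\<Sum>j\<in>UNIV. L $ m $ j * w j) \<le> W"
      unfolding W_def by (rule sum_norm_le) (simp add: norm_mult L mult_left_le_one_le)
    then have "cmod ((\<Sum>j\<in>UNIV. L $ m $ j * w j) + L $ m $ l) \<le> W + 1"
      using L[of m l] norm_triangle_mono by blast
    then have "cmod (\<epsilon> *\<^sub>R ((\<Sum>j\<in>UNIV. L $ m $ j * w j) + L $ m $ l)) \<le> \<epsilon> * (W + 1)"
      using \<epsilon>(1) by (simp add: mult_left_mono)
    then show "cmod (w m) \<le> cmod (v m) + \<epsilon> * ((\<Sum>m\<in>UNIV. cmod (w m)) + 1)"
      unfolding vw[of m] W_def[symmetric] using norm_triangle_ineq4 by (smt (verit))
  qed
  also have "\<dots> = V + (\<epsilon> * CARD('p)) * W + \<epsilon> * CARD('p)"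
    by (simp add: V_def sum.distrib algebra_simps)
  also have "(\<epsilon> * CARD('p)) * W \<le> 1/2 * W"
    by (rule mult_right_mono[OF \<epsilon>(2) W0])
  finally have V: "d / 4 \<le> V" using dW \<epsilon>(3) by simp
  \<comment> \<open>Some entry is at least the average of the column.\<close>
  obtain m where m: "d / (4 * CARD('p)) \<le> cmod (v m)"
  proof (rule ccontr)
    assume "\<not> thesis"
    with that have "\<And>m. cmod (v m) < d / (4 * CARD('p))" by (meson linorder_not_less)
    then have "V < of_nat CARD('p) * (d / (4 * CARD('p)))"
      unfolding V_def by (intro sum_bounded_above_strict) auto
    with V show False by simp
  qed
  have "(d / (4 * CARD('p)))\<^sup>2 \<le> (cmod (v m))\<^sup>2"
    using m d0 by (intro power_mono) auto
  also have "\<dots> \<le> (\<Sum>j\<in>UNIV. (cmod (((mat 1 + \<epsilon> *\<^sub>R L) ** g ** X - mat 1) $ m $ j))\<^sup>2)"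
    unfolding v_def by (rule member_le_sum) auto
  also have "\<dots> \<le> (\<Sum>i\<in>UNIV. \<Sum>j\<in>UNIV. (cmod (((mat 1 + \<epsilon> *\<^sub>R L) ** g ** X - mat 1) $ i $ j))\<^sup>2)"
    by (rule member_le_sum[where f = "\<lambda>i. \<Sum>j\<in>UNIV. (cmod (((mat 1 + \<epsilon> *\<^sub>R L) ** g ** X - mat 1) $ i $ j))\<^sup>2"])
      (auto intro: sum_nonneg)
  finally show ?thesis .
qed

section \<open>Residuals of explicit choices of X\<close>

lemma norm_diagonal_scaling_le:
  fixes z :: complex and \<epsilon> :: real
  assumes "cmod z \<le> 1" "0 \<le> \<epsilon>" "\<epsilon> \<le> 1/2"
  shows "1 + \<epsilon> *\<^sub>R z \<noteq> 0" and "cmod (inverse (1 + \<epsilon> *\<^sub>R z)) \<le> 2"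
proof -
  have "cmod (\<epsilon> *\<^sub>R z) \<le> 1/2 * 1"
    unfolding norm_scaleR using assms by (intro mult_mono) auto
  then have *: "1/2 \<le> cmod (1 + \<epsilon> *\<^sub>R z)"
    using norm_diff_ineq[of 1 "\<epsilon> *\<^sub>R z"] by simp
  then show "1 + \<epsilon> *\<^sub>R z \<noteq> 0" by auto
  show "cmod (inverse (1 + \<epsilon> *\<^sub>R z)) \<le> 2"
    using le_imp_inverse_le[OF *] by (simp add: norm_inverse)
qed

text \<open>Only the off-diagonal part of the perturbation is assumed square integrable. Dividing
  column \<open>j\<close> by \<open>1 + \<epsilon> L j j\<close> turns the diagonal entries into
  exactly 1, and since the divisor has modulus at least 1/2 it at most doubles the others.\<close>

lemma scaled_perturbation_bound:
  fixes L :: "complex^'p::finite^'p" and \<epsilon> :: real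
  assumes L: "\<And>i j. cmod (L $ i $ j) \<le> 1" and \<epsilon>: "0 \<le> \<epsilon>" "\<epsilon> \<le> 1/2"
  shows "cmod ((mat 1 + \<epsilon> *\<^sub>R L) $ i $ j * inverse (1 + \<epsilon> *\<^sub>R L $ j $ j) - mat 1 $ i $ j)
    \<le> 2 * \<epsilon> * (if i = j then 0 else cmod (L $ i $ j))"
proof (cases "i = j")
  case True
  then show ?thesis using norm_diagonal_scaling_le(1)[OF L \<epsilon>, of j j] by (simp add: mat_def)
next
  case False
  have "cmod (\<epsilon> *\<^sub>R L $ i $ j) * cmod (inverse (1 + \<epsilon> *\<^sub>R L $ j $ j)) \<le> cmod (\<epsilon> *\<^sub>R L $ i $ j) * 2"
    by (intro mult_left_mono norm_diagonal_scaling_le L \<epsilon>) auto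
  then show ?thesis using False \<epsilon> by (simp add: mat_def norm_mult mult_ac)
qed

text \<open>\<open>Y = pm^-1 (I - q)\<close> is the exact inverse of \<open>g\<close>, and
  \<open>X\<close> is \<open>Y\<close> with scaled columns. Hence \<open>g\<close> cancels and the
  column-scaled \<open>I + \<epsilon> L\<close> remains.\<close>

lemma residual_true_structure:
  fixes q g pm L X :: "complex^'p::finite^'p" and \<epsilon> :: real
  assumes eq: "(mat 1 - q) ** g = pm"
    and diag: "\<And>i j. i \<noteq> j \<Longrightarrow> pm $ i $ j = 0" and nz: "\<And>i. pm $ i $ i \<noteq> 0"
    and L: "\<And>i j. cmod (L $ i $ j) \<le> 1" and \<epsilon>: "0 \<le> \<epsilon>" "\<epsilon> \<le> 1/2"
    and X: "X = (\<chi> i j. (mat 1 - q) $ i $ j / pm $ i $ i * inverse (1 + \<epsilon> *\<^sub>R L $ j $ j))"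
  shows "cmod (((mat 1 + \<epsilon> *\<^sub>R L) ** g ** X - mat 1) $ i $ j)
    \<le> 2 * \<epsilon> * (if i = j then 0 else cmod (L $ i $ j))"
proof -
  define D where "D j = inverse (1 + \<epsilon> *\<^sub>R L $ j $ j)" for j
  define Y where "Y = (\<chi> i j. (mat 1 - q) $ i $ j / pm $ i $ i)"
  have "Y ** g = mat 1"
  proof -
    have "(Y ** g) $ i $ j = ((mat 1 - q) ** g) $ i $ j / pm $ i $ i" for i j
      by (simp add: matrix_matrix_mult_def Y_def sum_divide_distrib)
    then show ?thesis
      unfolding eq vec_eq_iff using diag nz by (auto simp: mat_def)
  qed
  \<comment> \<open>A left inverse of a square matrix is also a right inverse; the product in the
    residual has \<open>Y\<close> on the right.\<close>
  then have gY: "g ** Y = mat 1" using matrix_left_right_inverse by blast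
  have XY: "X = (\<chi> i j. Y $ i $ j * D j)" by (simp add: X Y_def D_def)
  have col: "(A ** X) $ i $ j = (A ** Y) $ i $ j * D j" for A :: "complex^'p^'p" and i j
    by (simp add: XY matrix_matrix_mult_def sum_distrib_right mult.assoc)
  have "((mat 1 + \<epsilon> *\<^sub>R L) ** g ** X) $ i $ j = (mat 1 + \<epsilon> *\<^sub>R L) $ i $ j * D j"
    unfolding col by (simp only: matrix_mul_assoc[symmetric] gY matrix_mul_rid)
  then show ?thesis
    using scaled_perturbation_bound[OF L \<epsilon>, of i j] by (simp add: D_def)
qed

text \<open>Up to the scaling by \<open>D\<close>, a diagonal \<open>X\<close> turns
  \<open>g\<close> into \<open>H = g pm^-1 = (I - q)^-1\<close>. For small \<open>q\<close> this is
  near the identity: \<open>H = I + E\<close> with \<open>E = q H\<close> of order \<eta>.\<close>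

lemma residual_decoupled_structure:
  fixes q g pm L X :: "complex^'p::finite^'p" and \<epsilon> \<eta> :: real
  assumes eq: "(mat 1 - q) ** g = pm"
    and diag: "\<And>i j. i \<noteq> j \<Longrightarrow> pm $ i $ j = 0" and nz: "\<And>i. pm $ i $ i \<noteq> 0"
    and L: "\<And>i j. cmod (L $ i $ j) \<le> 1" and \<epsilon>: "0 \<le> \<epsilon>" "\<epsilon> \<le> 1/2"
    and q: "\<And>i j. cmod (q $ i $ j) \<le> \<eta>" "CARD('p) * \<eta> \<le> 1/2"
    and X: "X = (\<chi> i j. if i = j then inverse (1 + \<epsilon> *\<^sub>R L $ j $ j) / pm $ j $ j else 0)"
  shows "cmod (((mat 1 + \<epsilon> *\<^sub>R L) ** g ** X - mat 1) $ i $ j)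
    \<le> (if i = j then 0 else cmod (L $ i $ j)) + 8 * CARD('p) * \<eta>"
proof -
  define D where "D j = inverse (1 + \<epsilon> *\<^sub>R L $ j $ j)" for j
  define H where "H = (\<chi> i j. g $ i $ j / pm $ j $ j)"
  define E where "E = q ** H"
  have \<eta>0: "\<eta> \<ge> 0" using q(1)[of i j] norm_ge_zero[of "q $ i $ j"] by linarith
  have "(mat 1 - q) ** H = mat 1"
  proof -
    have "((mat 1 - q) ** H) $ i $ j = ((mat 1 - q) ** g) $ i $ j / pm $ j $ j" for i j
      by (simp add: matrix_matrix_mult_def H_def sum_divide_distrib)
    then show ?thesis
      unfolding eq vec_eq_iff using diag nz by (auto simp: mat_def)
  qed
  then have HE: "H = mat 1 + E"
    by (simp add: E_def matrix_diff_rdistrib algebra_simps)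
  define S where "S = (\<Sum>m\<in>UNIV. cmod (H $ m $ j))"
  have S0: "S \<ge> 0" by (simp add: S_def sum_nonneg)
  have Esum: "E $ m $ j = (\<Sum>n\<in>UNIV. q $ m $ n * H $ n $ j)" for m
    by (simp add: E_def matrix_matrix_mult_def)
  \<comment> \<open>From \<open>H = I + q H\<close> the 1-norm of column \<open>j\<close> satisfies
    \<open>S \<le> 1 + S/2\<close>, hence \<open>S \<le> 2\<close>.\<close>
  have "S \<le> (\<Sum>m\<in>UNIV. cmod (mat 1 $ m $ j :: complex) + cmod (E $ m $ j))"
    unfolding S_def HE by (intro sum_mono) (simp add: norm_triangle_ineq)
  also have "\<dots> = (\<Sum>m\<in>UNIV. cmod (mat 1 $ m $ j :: complex)) + (\<Sum>m\<in>UNIV. cmod (E $ m $ j))"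
    by (rule sum.distrib)
  also have "(\<Sum>m\<in>UNIV. cmod (mat 1 $ m $ j :: complex)) = (\<Sum>m\<in>UNIV. if m = j then 1 else 0)"
    by (intro sum.cong) (auto simp: mat_def)
  also have "\<dots> = 1" by simp
  also have "(\<Sum>m\<in>UNIV. cmod (E $ m $ j)) \<le> CARD('p) * \<eta> * S"
    unfolding Esum S_def by (rule sum_cmod_mult_le(2)) (rule q(1))
  also have "\<dots> \<le> 1/2 * S" by (rule mult_right_mono[OF q(2) S0])
  finally have S2: "S \<le> 2" by simp
  have Ebound: "cmod (E $ m $ j) \<le> 2 * \<eta>" for m
  proof -
    have "cmod (E $ m $ j) \<le> \<eta> * S"
      unfolding Esum S_def by (rule sum_cmod_mult_le(1)) (rule q(1))
    also have "\<dots> \<le> \<eta> * 2" by (rule mult_left_mono[OF S2 \<eta>0])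
    finally show ?thesis by simp
  qed
  define M where "M = mat 1 + \<epsilon> *\<^sub>R L"
  have M: "cmod (M $ i $ m) \<le> 2" for m
  proof -
    have "cmod (M $ i $ m) \<le> cmod (mat 1 $ i $ m) + cmod (\<epsilon> *\<^sub>R L $ i $ m)"
      unfolding M_def vector_add_component vector_scaleR_component by (rule norm_triangle_ineq)
    also have "\<dots> \<le> 1 + 1 * 1"
      unfolding norm_scaleR using \<epsilon> L by (intro add_mono mult_mono) (auto simp: mat_def)
    finally show ?thesis by simp
  qed
  have ME: "cmod ((M ** E) $ i $ j) \<le> CARD('p) * (4 * \<eta>)"
  proof -
    have "cmod (\<Sum>m\<in>UNIV. M $ i $ m * E $ m $ j) \<le> (\<Sum>m\<in>(UNIV :: 'p set). 2 * (2 * \<eta>))"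
      unfolding norm_mult by (intro sum_norm_le, unfold norm_mult, intro mult_mono M Ebound) auto
    then show ?thesis by (simp add: matrix_matrix_mult_def)
  qed
  have XH: "(A ** X) $ i $ j = A $ i $ j / pm $ j $ j * D j" for A :: "complex^'p^'p" and i j
    by (simp add: X D_def matrix_matrix_mult_def if_distrib[of "\<lambda>x. _ * x"] cong: if_cong)
  have "(M ** g ** X) $ i $ j = (M ** H) $ i $ j * D j"
    by (simp add: XH) (simp add: matrix_matrix_mult_def H_def flip: sum_divide_distrib)
  also have "M ** H = M + M ** E" by (simp add: HE matrix_add_ldistrib)
  finally have "(M ** g ** X - mat 1) $ i $ j = (M $ i $ j * D j - mat 1 $ i $ j) + (M ** E) $ i $ j * D j"
    by (simp add: algebra_simps)
  \<comment> \<open>The error collects \<open>CARD('p)\<close> products of an entry of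
    \<open>M\<close>, at most 2, and one of \<open>E\<close>, at most \<open>2 * \<eta>\<close>,
    times the scaling factor, at most 2.\<close>
  also have "cmod \<dots> \<le> 2 * \<epsilon> * (if i = j then 0 else cmod (L $ i $ j)) + CARD('p) * (4 * \<eta>) * 2"
  proof (rule norm_triangle_mono)
    show "cmod (M $ i $ j * D j - mat 1 $ i $ j) \<le> 2 * \<epsilon> * (if i = j then 0 else cmod (L $ i $ j))"
      using scaled_perturbation_bound[OF L \<epsilon>, of i j] by (simp add: M_def D_def)
    have "cmod (D j) \<le> 2" unfolding D_def by (rule norm_diagonal_scaling_le(2)[OF L \<epsilon>])
    then show "cmod ((M ** E) $ i $ j * D j) \<le> CARD('p) * (4 * \<eta>) * 2"
      unfolding norm_mult using ME \<eta>0 by (intro mult_mono) auto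
  qed
  also have "2 * \<epsilon> * (if i = j then 0 else cmod (L $ i $ j)) \<le> 1 * (if i = j then 0 else cmod (L $ i $ j))"
    using \<epsilon> by (intro mult_right_mono) auto
  finally show ?thesis by (simp add: M_def)
qed

section \<open>Measurability and integrals\<close>

lemma borel_measurable_vecI:
  fixes f :: "'a \<Rightarrow> 'b::euclidean_space^'n::finite"
  assumes "\<And>i. (\<lambda>x. f x $ i) \<in> borel_measurable M"
  shows "f \<in> borel_measurable M"
proof -
  have "(\<lambda>x. f x \<bullet> b) \<in> borel_measurable M" if "b \<in> Basis" for b :: "'b^'n"
  proof -
    obtain i u where "b = axis i u" using \<open>b \<in> Basis\<close> by (auto simp: Basis_vec_def)
    then show ?thesis using assms[of i] by (simp add: inner_axis)
  qed
  then show ?thesis using borel_measurable_euclidean_space by blast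
qed

lemma borel_measurable_vec_nth:
  fixes f :: "'a \<Rightarrow> 'b::euclidean_space^'n::finite"
  assumes "f \<in> borel_measurable M"
  shows "(\<lambda>x. f x $ i) \<in> borel_measurable M"
  by (rule measurable_compose[OF assms borel_measurable_continuous_onI])
    (intro continuous_intros)

lemma borel_measurable_tf_eval:
  "(\<lambda>\<omega>. tf_eval f (\<i> * complex_of_real \<omega>)) \<in> borel_measurable borel"
  unfolding tf_eval_def case_prod_beta
  by (intro borel_measurable_divide borel_measurable_continuous_onI continuous_intros)

lemma borel_measurable_freq_response:
  "(\<lambda>\<omega>. freq_response M \<omega> $ k $ l) \<in> borel_measurable borel"
  using borel_measurable_tf_eval by (simp add: freq_response_def)

lemma AE_lborel_cofinite:
  assumes "\<forall>\<^sub>F x in cofinite. P x"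
  shows "AE x::real in lborel. P x"
  by (rule AE_I'[of "{x. \<not> P x}"])
    (use assms in \<open>auto simp: eventually_cofinite finite_imp_null_set_lborel\<close>)

lemma frob_norm_sq_eq:
  "frob_norm_sq D = ennreal (1 / (2 * pi)) *
    (\<integral>\<^sup>+ \<omega>. ennreal (\<Sum>k\<in>UNIV. \<Sum>l\<in>UNIV. (cmod (D \<omega> $ k $ l))\<^sup>2) \<partial>lborel)"
  by (simp add: frob_norm_sq_def sum_nonneg)

text \<open>Squared residuals of order \<open>1 / \<omega>^2\<close> at high frequency are dominated
  by a multiple of this integrand, which is also bounded near 0.\<close>

lemma nn_integral_inverse_1_plus_square:
  "(\<integral>\<^sup>+ x. ennreal (inverse (1 + x\<^sup>2)) \<partial>lborel) < \<infinity>"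
proof -
  have "einterval (-\<infinity>) \<infinity> = UNIV" by (auto simp: einterval_def)
  then have "integrable lborel (\<lambda>x::real. inverse (1 + x\<^sup>2))"
    using integrable_inverse_1_plus_square by (simp add: set_integrable_def)
  then show ?thesis
    by (simp add: integrable_iff_bounded)
qed

section \<open>Bounds for the distance to a structure\<close>

lemma delta_sq_antimono: "i \<subseteq> j \<Longrightarrow> delta_sq G j \<le> delta_sq G i"
  unfolding delta_sq_def
  by (rule INF_superset_mono) (auto simp: structured_mats_def)

text \<open>Scaling rows and columns preserves the zero pattern of \<open>I - Q\<close>, so the
  choice of \<open>residual_true_structure\<close> is feasible; its entrywise bound is then squared
  and integrated.\<close>

lemma delta_sq_true_structure_le:
  fixes Gt Q P :: "tf^'p::finite^'p" and \<Lambda>0 :: "real \<Rightarrow> complex^'p^'p" and \<epsilon> :: real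
  assumes dsf: "dsf Q P Gt" "diagonal_mat P" "rank Gt = CARD('p)"
    and \<Lambda>: "\<Lambda>0 \<in> borel_measurable borel" "\<And>\<omega> k l. cmod (\<Lambda>0 \<omega> $ k $ l) \<le> 1"
    and \<epsilon>: "0 \<le> \<epsilon>" "\<epsilon> \<le> 1/2"
  shows "delta_sq (perturbed Gt \<Lambda>0 \<epsilon>) (bool_structure Q)
    \<le> ennreal (4 * \<epsilon>\<^sup>2) * frob_norm_sq (off_diag \<Lambda>0)"
proof -
  define pm where "pm = freq_response P"
  define q where "q = freq_response Q"
  have diag: "pm \<omega> $ i $ j = 0" if "i \<noteq> j" for \<omega> i j
    using dsf(2) that by (simp add: pm_def freq_response_def diagonal_mat_def)
  define X where "X \<omega> = (\<chi> i j. (mat 1 - q \<omega>) $ i $ j / pm \<omega> $ i $ i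
      * inverse (1 + \<epsilon> *\<^sub>R \<Lambda>0 \<omega> $ j $ j))" for \<omega>
  have meas: "(\<lambda>\<omega>. \<Lambda>0 \<omega> $ i $ j) \<in> borel_measurable borel" for i j
    by (intro borel_measurable_vec_nth \<Lambda>(1))
  have "X \<in> borel_measurable borel"
    unfolding X_def pm_def q_def
    by (intro borel_measurable_vecI)
      (simp, intro borel_measurable_times borel_measurable_divide borel_measurable_diff
        borel_measurable_inverse borel_measurable_add borel_measurable_scaleR
        borel_measurable_const borel_measurable_freq_response meas)
  \<comment> \<open>The constraint is imposed at every frequency, poles of other entries included;
    it holds because \<open>tf_eval 0\<close> is 0 everywhere.\<close>
  moreover have "X \<omega> $ k $ l = 0" if "k \<noteq> l" "(k, l) \<notin> bool_structure Q" for \<omega> k l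
    using that by (simp add: X_def q_def freq_response_def bool_structure_def mat_def)
  ultimately have X: "X \<in> structured_mats (bool_structure Q)"
    by (auto simp: structured_mats_def)
  have "delta_sq (perturbed Gt \<Lambda>0 \<epsilon>) (bool_structure Q)
      \<le> frob_norm_sq (\<lambda>\<omega>. perturbed Gt \<Lambda>0 \<epsilon> \<omega> ** X \<omega> - mat 1)"
    unfolding delta_sq_def by (rule INF_lower[OF X])
  also have "\<dots> \<le> ennreal (1 / (2 * pi)) * (\<integral>\<^sup>+ \<omega>. ennreal (4 * \<epsilon>\<^sup>2) *
      ennreal (\<Sum>k\<in>UNIV. \<Sum>l\<in>UNIV. (cmod (off_diag \<Lambda>0 \<omega> $ k $ l))\<^sup>2) \<partial>lborel)"
    unfolding frob_norm_sq_eq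
  proof (intro mult_left_mono nn_integral_mono_AE)
    show "AE \<omega> in lborel.
      ennreal (\<Sum>k\<in>UNIV. \<Sum>l\<in>UNIV. (cmod ((perturbed Gt \<Lambda>0 \<epsilon> \<omega> ** X \<omega> - mat 1) $ k $ l))\<^sup>2)
      \<le> ennreal (4 * \<epsilon>\<^sup>2) * ennreal (\<Sum>k\<in>UNIV. \<Sum>l\<in>UNIV. (cmod (off_diag \<Lambda>0 \<omega> $ k $ l))\<^sup>2)"
      using AE_lborel_cofinite[OF dsf_frequency[OF dsf]]
    proof eventually_elim
      case (elim \<omega>)
      have "(cmod ((perturbed Gt \<Lambda>0 \<epsilon> \<omega> ** X \<omega> - mat 1) $ k $ l))\<^sup>2
          \<le> 4 * \<epsilon>\<^sup>2 * (cmod (off_diag \<Lambda>0 \<omega> $ k $ l))\<^sup>2" for k l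
      proof -
        have "cmod ((perturbed Gt \<Lambda>0 \<epsilon> \<omega> ** X \<omega> - mat 1) $ k $ l)
            \<le> 2 * \<epsilon> * (if k = l then 0 else cmod (\<Lambda>0 \<omega> $ k $ l))"
          unfolding perturbed_def
          by (rule residual_true_structure[where q = "q \<omega>" and pm = "pm \<omega>"])
            (use elim \<epsilon> \<Lambda>(2) diag in \<open>auto simp: q_def pm_def X_def\<close>)
        also have "\<dots> = 2 * \<epsilon> * cmod (off_diag \<Lambda>0 \<omega> $ k $ l)"
          by (simp add: off_diag_def)
        finally have "(cmod ((perturbed Gt \<Lambda>0 \<epsilon> \<omega> ** X \<omega> - mat 1) $ k $ l))\<^sup>2
            \<le> (2 * \<epsilon> * cmod (off_diag \<Lambda>0 \<omega> $ k $ l))\<^sup>2"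
          by (rule power_mono) simp
        then show ?thesis by (simp add: power_mult_distrib)
      qed
      then have "(\<Sum>k\<in>UNIV. \<Sum>l\<in>UNIV. (cmod ((perturbed Gt \<Lambda>0 \<epsilon> \<omega> ** X \<omega> - mat 1) $ k $ l))\<^sup>2)
          \<le> 4 * \<epsilon>\<^sup>2 * (\<Sum>k\<in>UNIV. \<Sum>l\<in>UNIV. (cmod (off_diag \<Lambda>0 \<omega> $ k $ l))\<^sup>2)"
        unfolding sum_distrib_left by (intro sum_mono)
      then show ?case by (simp add: ennreal_mult[symmetric] sum_nonneg ennreal_leI)
    qed
  qed simp
  also have "\<dots> = ennreal (4 * \<epsilon>\<^sup>2) * frob_norm_sq (off_diag \<Lambda>0)"
  proof -
    have "(\<lambda>\<omega>. cmod (off_diag \<Lambda>0 \<omega> $ k $ l)) \<in> borel_measurable borel" for k l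
      unfolding off_diag_def using meas[of k l] by (cases "k = l") auto
    then have "(\<lambda>\<omega>. ennreal (\<Sum>k\<in>UNIV. \<Sum>l\<in>UNIV. (cmod (off_diag \<Lambda>0 \<omega> $ k $ l))\<^sup>2)) \<in> borel_measurable lborel"
      by measurable
    then show ?thesis
      unfolding frob_norm_sq_eq by (subst nn_integral_cmult) (simp_all only: mult.left_commute)
  qed
  finally show ?thesis .
qed

text \<open>The columns of \<open>X\<close> are rescaled to unit vectors at high frequency; on the remaining bounded
  band, which may contain poles, \<open>X = 0\<close> is good enough.\<close>

lemma delta_sq_bounded:
  fixes Gt Q P :: "tf^'p::finite^'p" and \<Lambda>0 :: "real \<Rightarrow> complex^'p^'p"
  assumes dsf: "dsf Q P Gt" "diagonal_mat P" "rank Gt = CARD('p)"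
    and \<Lambda>: "\<Lambda>0 \<in> borel_measurable borel" "\<And>\<omega> k l. cmod (\<Lambda>0 \<omega> $ k $ l) \<le> 1"
    and fin: "frob_norm_sq (off_diag \<Lambda>0) < \<infinity>"
  obtains C :: real where "C \<ge> 0"
    "\<And>\<epsilon> n. 0 \<le> \<epsilon> \<Longrightarrow> \<epsilon> \<le> 1/2 \<Longrightarrow> delta_sq (perturbed Gt \<Lambda>0 \<epsilon>) n \<le> ennreal C"
proof -
  define p where "p = real CARD('p)"
  have p0: "p > 0" by (simp add: p_def)
  define pm where "pm = freq_response P"
  define q where "q = freq_response Q"
  have diag: "pm \<omega> $ i $ j = 0" if "i \<noteq> j" for \<omega> i j
    using dsf(2) that by (simp add: pm_def freq_response_def diagonal_mat_def)
  have meas: "(\<lambda>\<omega>. \<Lambda>0 \<omega> $ i $ j) \<in> borel_measurable borel" for i j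
    by (intro borel_measurable_vec_nth \<Lambda>(1))
  obtain K where K: "K \<ge> 0"
    and "\<forall>\<^sub>F \<omega> in at_infinity. \<forall>k l. cmod (q \<omega> $ k $ l) \<le> K / \<bar>\<omega>\<bar>"
    unfolding q_def
    by (rule strictly_proper_matrix_bound[of Q]) (use dsf(1) in \<open>auto simp: dsf_def\<close>)
  then obtain R0 where R0: "\<And>\<omega> k l. R0 \<le> \<bar>\<omega>\<bar> \<Longrightarrow> cmod (q \<omega> $ k $ l) \<le> K / \<bar>\<omega>\<bar>"
    unfolding eventually_at_infinity real_norm_def by blast
  \<comment> \<open>For \<open>\<bar>\<omega>\<bar> \<ge> R\<close> the decay bound on
    \<open>q\<close> is valid, \<open>1 / \<omega>^2\<close> is at most
    \<open>2 / (1 + \<omega>^2)\<close>, and \<open>p * K / \<bar>\<omega>\<bar> \<le> 1/2\<close>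
    as \<open>residual_decoupled_structure\<close> requires.\<close>
  define R where "R = max R0 (max 1 (2 * p * K))"
  \<comment> \<open>The first summand covers high frequencies, where
    \<open>2 (8 p K / \<omega>)^2 \<le> 256 p^2 K^2 / (1 + \<omega>^2)\<close>. The term
    \<open>1 + R^2\<close> makes \<open>c / (1 + \<omega>^2)\<close> at least 1 on the band
    \<open>\<bar>\<omega>\<bar> < R\<close>, where the residual is \<open>-I\<close>.\<close>
  define c where "c = 256 * p\<^sup>2 * K\<^sup>2 + 1 + R\<^sup>2"
  \<comment> \<open>A majorant of the integrand independent of \<epsilon>: the factor 2 comes from
    \<open>(x + y)^2 \<le> 2 x^2 + 2 y^2\<close>, and \<open>p^2\<close> counts the entries.\<close>
  define U where "U \<omega> = 2 * (\<Sum>k\<in>UNIV. \<Sum>l\<in>UNIV. (cmod (off_diag \<Lambda>0 \<omega> $ k $ l))\<^sup>2)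
      + p\<^sup>2 * c * inverse (1 + \<omega>\<^sup>2)" for \<omega>
  define C where "C = ennreal (1 / (2 * pi)) * (\<integral>\<^sup>+ \<omega>. ennreal (U \<omega>) \<partial>lborel)"
  have c0: "c \<ge> 0" by (simp add: c_def)

  have meas_off: "(\<lambda>\<omega>. cmod (off_diag \<Lambda>0 \<omega> $ k $ l)) \<in> borel_measurable borel" for k l
    unfolding off_diag_def using meas[of k l] by (cases "k = l") auto
  have "C = 2 * frob_norm_sq (off_diag \<Lambda>0) + ennreal (1 / (2 * pi)) *
      (ennreal (p\<^sup>2 * c) * (\<integral>\<^sup>+ \<omega>. ennreal (inverse (1 + \<omega>\<^sup>2)) \<partial>lborel))"
  proof -
    define f where "f \<omega> = (\<Sum>k\<in>UNIV. \<Sum>l\<in>UNIV. (cmod (off_diag \<Lambda>0 \<omega> $ k $ l))\<^sup>2)" for \<omega>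
    have f: "f \<in> borel_measurable borel" unfolding f_def using meas_off by measurable
    have f0: "f \<omega> \<ge> 0" for \<omega> by (simp add: f_def sum_nonneg)
    have "ennreal (U \<omega>) = 2 * ennreal (f \<omega>) + ennreal (p\<^sup>2 * c) * ennreal (inverse (1 + \<omega>\<^sup>2))" for \<omega>
      using f0[of \<omega>] c0 unfolding U_def f_def[symmetric]
      by (subst ennreal_plus) (auto simp: ennreal_mult ennreal_mult'')
    then have "(\<integral>\<^sup>+ \<omega>. ennreal (U \<omega>) \<partial>lborel) =
        2 * (\<integral>\<^sup>+ \<omega>. ennreal (f \<omega>) \<partial>lborel) +
        ennreal (p\<^sup>2 * c) * (\<integral>\<^sup>+ \<omega>. ennreal (inverse (1 + \<omega>\<^sup>2)) \<partial>lborel)"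
      using f by (simp add: nn_integral_add nn_integral_cmult)
    then show ?thesis
      by (simp add: C_def frob_norm_sq_eq f_def[symmetric] distrib_left mult.left_commute)
  qed
  then have "C < \<infinity>"
    using fin nn_integral_inverse_1_plus_square by (simp add: ennreal_mult_less_top)
  then obtain C' where C': "C' \<ge> 0" "C = ennreal C'" by (cases C) auto

  have "delta_sq (perturbed Gt \<Lambda>0 \<epsilon>) n \<le> C" if \<epsilon>: "0 \<le> \<epsilon>" "\<epsilon> \<le> 1/2" for \<epsilon> n
  proof -
    define X where "X \<omega> = (\<chi> i j. if i = j then
        (if R \<le> \<bar>\<omega>\<bar> then inverse (1 + \<epsilon> *\<^sub>R \<Lambda>0 \<omega> $ j $ j) / pm \<omega> $ j $ j else 0) else 0)" for \<omega>
    have "(\<lambda>\<omega>. if R \<le> \<bar>\<omega>\<bar> then inverse (1 + \<epsilon> *\<^sub>R \<Lambda>0 \<omega> $ j $ j) / pm \<omega> $ j $ j else 0)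
        \<in> borel_measurable borel" for j
    proof (rule measurable_If)
      show "(\<lambda>\<omega>. inverse (1 + \<epsilon> *\<^sub>R \<Lambda>0 \<omega> $ j $ j) / pm \<omega> $ j $ j) \<in> borel_measurable borel"
        unfolding pm_def
        by (intro borel_measurable_divide borel_measurable_inverse borel_measurable_add
            borel_measurable_scaleR borel_measurable_const borel_measurable_freq_response meas)
    qed auto
    then have "X \<in> borel_measurable borel"
      unfolding X_def by (intro borel_measurable_vecI) simp
    then have X: "X \<in> structured_mats {}"
      by (auto simp: structured_mats_def X_def)
    \<comment> \<open>A diagonal \<open>X\<close> is feasible for every structure, so one estimate
      serves all \<open>n\<close>.\<close>
    have "delta_sq (perturbed Gt \<Lambda>0 \<epsilon>) n \<le> delta_sq (perturbed Gt \<Lambda>0 \<epsilon>) {}"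
      by (rule delta_sq_antimono) simp
    also have "\<dots> \<le> frob_norm_sq (\<lambda>\<omega>. perturbed Gt \<Lambda>0 \<epsilon> \<omega> ** X \<omega> - mat 1)"
      unfolding delta_sq_def by (rule INF_lower[OF X])
    also have "\<dots> \<le> C"
      unfolding frob_norm_sq_eq C_def
    proof (intro mult_left_mono nn_integral_mono_AE)
      show "AE \<omega> in lborel. ennreal (\<Sum>k\<in>UNIV. \<Sum>l\<in>UNIV.
          (cmod ((perturbed Gt \<Lambda>0 \<epsilon> \<omega> ** X \<omega> - mat 1) $ k $ l))\<^sup>2) \<le> ennreal (U \<omega>)"
        using AE_lborel_cofinite[OF dsf_frequency[OF dsf]]
      proof eventually_elim
        case (elim \<omega>)
        have "(cmod ((perturbed Gt \<Lambda>0 \<epsilon> \<omega> ** X \<omega> - mat 1) $ k $ l))\<^sup>2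
            \<le> 2 * (cmod (off_diag \<Lambda>0 \<omega> $ k $ l))\<^sup>2 + c * inverse (1 + \<omega>\<^sup>2)" for k l
        proof (cases "R \<le> \<bar>\<omega>\<bar>")
          case True
          then have \<omega>: "1 \<le> \<bar>\<omega>\<bar>" "R0 \<le> \<bar>\<omega>\<bar>" "2 * p * K \<le> \<bar>\<omega>\<bar>" by (auto simp: R_def)
          have "cmod ((perturbed Gt \<Lambda>0 \<epsilon> \<omega> ** X \<omega> - mat 1) $ k $ l)
              \<le> (if k = l then 0 else cmod (\<Lambda>0 \<omega> $ k $ l)) + 8 * CARD('p) * (K / \<bar>\<omega>\<bar>)"
            unfolding perturbed_def
          proof (rule residual_decoupled_structure[where q = "q \<omega>" and pm = "pm \<omega>"])
            show "real CARD('p) * (K / \<bar>\<omega>\<bar>) \<le> 1/2"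
              using \<omega> by (simp add: field_simps p_def)
          qed (use elim \<epsilon> \<Lambda>(2) diag R0[OF \<omega>(2)] True in \<open>auto simp: q_def pm_def X_def cong: if_cong\<close>)
          also have "\<dots> = cmod (off_diag \<Lambda>0 \<omega> $ k $ l) + 8 * p * K / \<bar>\<omega>\<bar>"
            by (simp add: off_diag_def p_def)
          finally have "(cmod ((perturbed Gt \<Lambda>0 \<epsilon> \<omega> ** X \<omega> - mat 1) $ k $ l))\<^sup>2
              \<le> (cmod (off_diag \<Lambda>0 \<omega> $ k $ l) + 8 * p * K / \<bar>\<omega>\<bar>)\<^sup>2"
            by (rule power_mono) simp
          also have "\<dots> \<le> 2 * (cmod (off_diag \<Lambda>0 \<omega> $ k $ l))\<^sup>2 + 2 * (8 * p * K / \<bar>\<omega>\<bar>)\<^sup>2"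
            using sum_squares_bound[of "cmod (off_diag \<Lambda>0 \<omega> $ k $ l)" "8 * p * K / \<bar>\<omega>\<bar>"]
            unfolding power2_sum by linarith
          also have "2 * (8 * p * K / \<bar>\<omega>\<bar>)\<^sup>2 = 128 * p\<^sup>2 * K\<^sup>2 * inverse (\<omega>\<^sup>2)"
            by (simp add: power_mult_distrib divide_inverse power_inverse)
          also have "\<dots> \<le> 128 * p\<^sup>2 * K\<^sup>2 * (2 * inverse (1 + \<omega>\<^sup>2))"
          proof (rule mult_left_mono)
            have "1 \<le> \<omega>\<^sup>2" using power_mono[OF \<omega>(1), of 2] by simp
            then have "inverse (\<omega>\<^sup>2) \<le> inverse ((1 + \<omega>\<^sup>2) / 2)"
              by (intro le_imp_inverse_le) auto
            then show "inverse (\<omega>\<^sup>2) \<le> 2 * inverse (1 + \<omega>\<^sup>2)"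
              by (simp add: inverse_eq_divide)
          qed simp
          also have "\<dots> \<le> c * inverse (1 + \<omega>\<^sup>2)"
            unfolding mult.assoc[symmetric] by (rule mult_right_mono) (auto simp: c_def)
          finally show ?thesis by simp
        next
          case False
          then have "X \<omega> = 0" by (simp add: X_def vec_eq_iff)
          then have "(cmod ((perturbed Gt \<Lambda>0 \<epsilon> \<omega> ** X \<omega> - mat 1) $ k $ l))\<^sup>2 \<le> 1"
            by (simp add: mat_def matrix_matrix_mult_def)
          also have "1 \<le> c * inverse (1 + \<omega>\<^sup>2)"
          proof -
            have "\<omega>\<^sup>2 \<le> R\<^sup>2" using False power_mono[of "\<bar>\<omega>\<bar>" R 2] by simp
            moreover have "0 \<le> 256 * p\<^sup>2 * K\<^sup>2" by simp
            ultimately have "1 + \<omega>\<^sup>2 \<le> c" unfolding c_def by linarith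
            moreover have "0 < 1 + \<omega>\<^sup>2" by (simp add: add_pos_nonneg)
            ultimately show ?thesis by (simp add: field_simps)
          qed
          also have "\<dots> \<le> 2 * (cmod (off_diag \<Lambda>0 \<omega> $ k $ l))\<^sup>2 + c * inverse (1 + \<omega>\<^sup>2)"
            by simp
          finally show ?thesis .
        qed
        then have "(\<Sum>k\<in>UNIV. \<Sum>l\<in>UNIV. (cmod ((perturbed Gt \<Lambda>0 \<epsilon> \<omega> ** X \<omega> - mat 1) $ k $ l))\<^sup>2)
            \<le> (\<Sum>k\<in>UNIV. \<Sum>l\<in>(UNIV :: 'p set).
                2 * (cmod (off_diag \<Lambda>0 \<omega> $ k $ l))\<^sup>2 + c * inverse (1 + \<omega>\<^sup>2))"
          by (intro sum_mono)
        also have "\<dots> = U \<omega>"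
          by (simp add: U_def sum.distrib sum_distrib_left p_def power2_eq_square)
        finally show ?case by (rule ennreal_leI)
      qed
    qed simp
    finally show ?thesis .
  qed
  then show ?thesis using that C' by simp
qed

text \<open>Row \<open>k\<close> of \<open>(I - Q) (Gt X - I) = P X - (I - Q)\<close> reads \<open>Q k l\<close> in column \<open>l\<close> if
  \<open>X k l = 0\<close>, so that the residual is bounded below wherever \<open>Q k l\<close> is.\<close>

lemma delta_sq_missing_link:
  fixes Gt Q P :: "tf^'p::finite^'p" and \<Lambda>0 :: "real \<Rightarrow> complex^'p^'p"
  assumes dsf: "dsf Q P Gt" "diagonal_mat P" "rank Gt = CARD('p)"
    and \<Lambda>: "\<And>\<omega> k l. cmod (\<Lambda>0 \<omega> $ k $ l) \<le> 1"
    and kl: "(k, l) \<in> bool_structure Q"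
  shows "\<exists>c>0. \<forall>\<epsilon> n. 0 \<le> \<epsilon> \<and> \<epsilon> < c \<and> (k, l) \<notin> n \<longrightarrow>
    ennreal c \<le> delta_sq (perturbed Gt \<Lambda>0 \<epsilon>) n"
proof -
  define pm where "pm = freq_response P"
  define q where "q = freq_response Q"
  have diag: "pm \<omega> $ i $ j = 0" if "i \<noteq> j" for \<omega> i j
    using dsf(2) that by (simp add: pm_def freq_response_def diagonal_mat_def)
  define s where "s \<omega> = 1 + (\<Sum>m\<in>UNIV. cmod (q \<omega> $ k $ m))" for \<omega>
  have s: "s \<omega> > 0" for \<omega> unfolding s_def by (intro add_pos_nonneg sum_nonneg) auto
  \<comment> \<open>The largest value that the premise \<open>d\<close> of
    \<open>residual_lower_bound\<close> admits at \<omega>.\<close>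
  define d where "d \<omega> = cmod (q \<omega> $ k $ l) / s \<omega>" for \<omega>
  have [measurable]: "(\<lambda>\<omega>. q \<omega> $ i $ j) \<in> borel_measurable borel" for i j
    unfolding q_def by (rule borel_measurable_freq_response)
  have [measurable]: "d \<in> borel_measurable borel" unfolding d_def s_def by measurable
  have "k \<noteq> l" "Q $ k $ l \<noteq> 0" using kl by (auto simp: bool_structure_def)
  have d_pos: "AE \<omega> in lborel. d \<omega> > 0"
    using AE_lborel_cofinite[OF eventually_tf_eval_nonzero[OF \<open>Q $ k $ l \<noteq> 0\<close>]]
    by eventually_elim (use s in \<open>simp add: d_def q_def freq_response_def\<close>)
  \<comment> \<open>If all these level sets were null, so would be their countable union, which
    contains almost every frequency because \<open>d\<close> is positive almost everywhere.\<close>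
  have "\<exists>N::nat. emeasure lborel {\<omega>. inverse (of_nat (Suc N)) \<le> d \<omega>} \<noteq> 0"
  proof (rule ccontr)
    assume "\<not> ?thesis"
    then have "AE \<omega> in lborel. \<forall>N::nat. \<not> inverse (of_nat (Suc N)) \<le> d \<omega>"
      unfolding AE_all_countable by (intro allI AE_I[where N = "{\<omega>. inverse (of_nat (Suc _)) \<le> d \<omega>}"]) auto
    with d_pos have "AE \<omega>::real in lborel. False"
    proof eventually_elim
      case (elim \<omega>)
      then show ?case using reals_Archimedean[of "d \<omega>"] by (auto dest: less_imp_le)
    qed
    then have "ae_filter (lborel :: real measure) = bot" by (simp add: trivial_limit_def)
    then show False by (simp add: ae_filter_eq_bot_iff)
  qed
  then obtain N :: nat where N: "emeasure lborel {\<omega>. inverse (of_nat (Suc N)) \<le> d \<omega>} \<noteq> 0" by blast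
  define d0 :: real where "d0 = inverse (of_nat (Suc N))"
  define A where "A = {\<omega>. d0 \<le> d \<omega>}"
  have A: "emeasure lborel A \<noteq> 0" using N by (simp add: A_def d0_def)
  have A_sets: "A \<in> sets lborel" unfolding A_def by measurable
  have d0: "d0 > 0" by (simp add: d0_def)
  define b where "b = ennreal (1 / (2 * pi)) * (ennreal ((d0 / (4 * CARD('p)))\<^sup>2) * emeasure lborel A)"
  have "b \<noteq> 0" using A d0 by (simp add: b_def)
  \<comment> \<open>The set \<open>A\<close> may have infinite measure, so a finite positive number
    below \<open>b\<close> is chosen.\<close>
  then obtain c0 :: real where c0: "c0 > 0" "ennreal c0 \<le> b"
  proof (cases b)
    case (real r)
    then show ?thesis using \<open>b \<noteq> 0\<close> that[of r] by auto
  next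
    case top
    then show ?thesis using that[of 1] by simp
  qed
  \<comment> \<open>One constant bounds both the distance from below and \<epsilon> from above; the
    second term yields the two smallness conditions of \<open>residual_lower_bound\<close>.\<close>
  define c where "c = min c0 (min 1 d0 / (4 * CARD('p)))"
  have "ennreal c \<le> delta_sq (perturbed Gt \<Lambda>0 \<epsilon>) n"
    if \<epsilon>: "0 \<le> \<epsilon>" "\<epsilon> < c" and n: "(k, l) \<notin> n" for \<epsilon> n
    unfolding delta_sq_def
  proof (rule INF_greatest)
    fix X :: "real \<Rightarrow> complex^'p^'p" assume "X \<in> structured_mats n"
    then have X: "X \<omega> $ k $ l = 0" for \<omega>
      using n \<open>k \<noteq> l\<close> by (auto simp: structured_mats_def)
    have "\<epsilon> < min 1 d0 / (4 * CARD('p))" using \<epsilon> by (simp add: c_def)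
    then have \<epsilon>': "\<epsilon> * CARD('p) \<le> min 1 d0 / 4" by (simp add: field_simps)
    have "ennreal c \<le> ennreal c0" by (rule ennreal_leI) (simp add: c_def)
    also note c0(2)
    also have "b = ennreal (1 / (2 * pi)) *
        (\<integral>\<^sup>+ \<omega>. ennreal ((d0 / (4 * CARD('p)))\<^sup>2) * indicator A \<omega> \<partial>lborel)"
      by (simp only: b_def nn_integral_cmult_indicator[OF A_sets])
    also have "\<dots> \<le> frob_norm_sq (\<lambda>\<omega>. perturbed Gt \<Lambda>0 \<epsilon> \<omega> ** X \<omega> - mat 1)"
      unfolding frob_norm_sq_eq
    proof (intro mult_left_mono nn_integral_mono_AE)
      show "AE \<omega> in lborel. ennreal ((d0 / (4 * CARD('p)))\<^sup>2) * indicator A \<omega> \<le>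
          ennreal (\<Sum>i\<in>UNIV. \<Sum>j\<in>UNIV. (cmod ((perturbed Gt \<Lambda>0 \<epsilon> \<omega> ** X \<omega> - mat 1) $ i $ j))\<^sup>2)"
        using AE_lborel_cofinite[OF dsf_frequency[OF dsf]]
      proof eventually_elim
        case (elim \<omega>)
        show ?case
        proof (cases "\<omega> \<in> A")
          case True
          have "(d0 / (4 * CARD('p)))\<^sup>2 \<le>
            (\<Sum>i\<in>UNIV. \<Sum>j\<in>UNIV. (cmod ((perturbed Gt \<Lambda>0 \<epsilon> \<omega> ** X \<omega> - mat 1) $ i $ j))\<^sup>2)"
            unfolding perturbed_def
          proof (rule residual_lower_bound[where q = "q \<omega>" and pm = "pm \<omega>" and k = k and l = l])
            show "d0 * (1 + (\<Sum>m\<in>UNIV. cmod (q \<omega> $ k $ m))) \<le> cmod (q \<omega> $ k $ l)"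
              using True s[of \<omega>] unfolding s_def[symmetric] by (simp add: A_def d_def field_simps)
          qed (use elim \<epsilon>(1) \<epsilon>' \<Lambda> diag X \<open>k \<noteq> l\<close> in \<open>auto simp: q_def pm_def\<close>)
          then show ?thesis using True by (simp add: ennreal_leI)
        qed simp
      qed
    qed simp
    finally show "ennreal c \<le> frob_norm_sq (\<lambda>\<omega>. perturbed Gt \<Lambda>0 \<epsilon> \<omega> ** X \<omega> - mat 1)" .
  qed
  moreover have "c > 0" using c0 d0 by (simp add: c_def)
  ultimately show ?thesis by blast
qed

section \<open>Method \<open>M\<^sub>2\<close>\<close>

text \<open>Descending induction on the number of links. While more than \<open>card T\<close> links
  are left, one of them lies outside \<open>T\<close>; removing it gives a candidate that strictly
  beats every candidate lacking a link of \<open>T\<close>, so ties are harmless. With exactly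
  \<open>card T\<close> links a superset of \<open>T\<close> is \<open>T\<close>.\<close>

lemma M2_solvable_if_separated:
  fixes T :: "'p::finite links"
  assumes T: "T \<subseteq> full_structure"
    and sep: "\<And>n a. non_allowable T n \<Longrightarrow> allowable T a \<Longrightarrow> card a = card n \<Longrightarrow>
      delta_sq G a < delta_sq G n"
  shows "M2_solvable G T"
  unfolding M2_solvable_def
proof (intro allI impI)
  fix S :: "nat \<Rightarrow> 'p links" assume run: "M2_run G S"
  define N where "N = CARD('p)\<^sup>2 - CARD('p)"
  have TN: "card T \<le> N"
    using card_mono[OF _ T] by (simp add: card_full_structure N_def)
  have "T \<subseteq> S (card T) \<and> S (card T) \<subseteq> full_structure \<and> card (S (card T)) = card T"
    using TN
  proof (induction rule: inc_induct)
    case base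
    then show ?case
      using run T by (simp add: M2_run_def N_def[symmetric] card_full_structure)
  next
    case (step j)
    have "is_arg_min (delta_sq G) (\<lambda>R. R \<in> link_removals (S (Suc j))) (S j)"
      using run step.hyps unfolding M2_run_def N_def[symmetric]
      by (auto dest!: bspec[where x = "Suc j"])
    then have mem: "S j \<in> link_removals (S (Suc j))"
      and min: "\<And>R. R \<in> link_removals (S (Suc j)) \<Longrightarrow> \<not> delta_sq G R < delta_sq G (S j)"
      by (auto simp: is_arg_min_def)
    have removed: "R \<subseteq> full_structure \<and> card R = j" if "R \<in> link_removals (S (Suc j))" for R
      using that step.IH by (auto simp: link_removals_def)
    have "\<not> S (Suc j) \<subseteq> T"
      using step.IH step.hyps card_mono[of T "S (Suc j)"] by auto
    then obtain e where e: "e \<in> S (Suc j)" "e \<notin> T" by blast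
    define a where "a = S (Suc j) - {e}"
    have a: "a \<in> link_removals (S (Suc j))" using e unfolding link_removals_def a_def by blast
    have "T \<subseteq> S j"
    proof (rule ccontr)
      assume "\<not> T \<subseteq> S j"
      then have "non_allowable T (S j)"
        using removed[OF mem] step.hyps by (auto simp: non_allowable_def allowable_def)
      moreover have "allowable T a"
        using removed[OF a] step.IH e by (auto simp: allowable_def a_def)
      ultimately have "delta_sq G a < delta_sq G (S j)"
        using sep removed[OF mem] removed[OF a] by simp
      with min[OF a] show False by blast
    qed
    with removed[OF mem] show ?case by blast
  qed
  then have "S (card T) = T" by (metis card_subset_eq finite)
  then show "T \<in> S ` {0..CARD('p)\<^sup>2 - CARD('p)}"
    using TN by (metis N_def atLeastAtMost_iff imageI zero_le)
qed

theorem theorem1: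
  fixes Gt Q P :: "tf^'p::finite^'p"
    and \<Lambda>0 :: "real \<Rightarrow> complex^'p^'p"
  assumes "dsf Q P Gt"
    and "diagonal_mat P"
    and "rank Gt = CARD('p)"
    and "\<Lambda>0 \<in> borel_measurable borel"
    and "Max (range (\<lambda>(k, l). linf_norm (\<lambda>\<omega>. \<Lambda>0 \<omega> $ k $ l))) = 1"
    and "frob_norm_sq (off_diag \<Lambda>0) < \<infinity>"
  shows "\<exists>r>0.
    (\<forall>\<epsilon>. 0 \<le> \<epsilon> \<and> \<epsilon> < r \<longrightarrow> M2_solvable (perturbed Gt \<Lambda>0 \<epsilon>) (bool_structure Q)) \<and>
    (\<exists>(B :: 'p links \<Rightarrow> real) (F :: 'p links \<Rightarrow> 'p links \<Rightarrow> real \<Rightarrow> real).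
      \<forall>n. non_allowable (bool_structure Q) n \<longrightarrow>
        B n > 0 \<and>
        (\<forall>a. allowable (bool_structure Q) a \<and> card a = card n \<longrightarrow>
          (\<forall>\<epsilon>. 0 \<le> \<epsilon> \<and> \<epsilon> < r \<longrightarrow>
            enn2ereal (delta_sq (perturbed Gt \<Lambda>0 \<epsilon>) n) - enn2ereal (delta_sq (perturbed Gt \<Lambda>0 \<epsilon>) a)
              = ereal (B n + F n a \<epsilon>) \<and>
            \<bar>F n a \<epsilon>\<bar> < B n)))"
proof -
  define T where "T = bool_structure Q"
  have T: "T \<subseteq> full_structure" by (auto simp: T_def bool_structure_def full_structure_def)
  \<comment> \<open>The normalisation of \<open>\<Lambda>0\<close> makes \<epsilon> the size of the
    perturbation and bounds every entry at every frequency.\<close>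
  have \<Lambda>: "cmod (\<Lambda>0 \<omega> $ k $ l) \<le> 1" for \<omega> k l
  proof -
    have "ennreal (cmod (\<Lambda>0 \<omega> $ k $ l)) \<le> linf_norm (\<lambda>\<omega>. \<Lambda>0 \<omega> $ k $ l)"
      unfolding linf_norm_def by (rule SUP_upper) simp
    also have "\<dots> \<le> Max (range (\<lambda>(k, l). linf_norm (\<lambda>\<omega>. \<Lambda>0 \<omega> $ k $ l)))"
      by (rule Max_ge) (auto intro: range_eqI[where x = "(k, l)"])
    finally show ?thesis using assms(5) by simp
  qed
  obtain C where C: "C \<ge> 0"
    "\<And>\<epsilon> n. 0 \<le> \<epsilon> \<Longrightarrow> \<epsilon> \<le> 1/2 \<Longrightarrow> delta_sq (perturbed Gt \<Lambda>0 \<epsilon>) n \<le> ennreal C"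
    using delta_sq_bounded[OF assms(1-4) \<Lambda> assms(6)] by blast
  have "\<exists>c. \<forall>e\<in>T. c e > 0 \<and> (\<forall>\<epsilon> n. 0 \<le> \<epsilon> \<and> \<epsilon> < c e \<and> e \<notin> n \<longrightarrow>
      ennreal (c e) \<le> delta_sq (perturbed Gt \<Lambda>0 \<epsilon>) n)"
  proof (intro bchoice ballI)
    fix e assume "e \<in> T"
    then obtain k l where e: "e = (k, l)" "(k, l) \<in> bool_structure Q"
      by (cases e) (auto simp: T_def)
    show "\<exists>c>0. \<forall>\<epsilon> n. 0 \<le> \<epsilon> \<and> \<epsilon> < c \<and> e \<notin> n \<longrightarrow>
        ennreal c \<le> delta_sq (perturbed Gt \<Lambda>0 \<epsilon>) n"
      unfolding e(1) by (rule delta_sq_missing_link[OF assms(1-3) \<Lambda> e(2)])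
  qed
  then obtain c where c: "\<And>e. e \<in> T \<Longrightarrow> c e > 0"
    "\<And>e \<epsilon> n. e \<in> T \<Longrightarrow> 0 \<le> \<epsilon> \<Longrightarrow> \<epsilon> < c e \<Longrightarrow> e \<notin> n \<Longrightarrow>
      ennreal (c e) \<le> delta_sq (perturbed Gt \<Lambda>0 \<epsilon>) n"
    by blast
  \<comment> \<open>There are finitely many links, so the bound is uniform over the missing link;
    the element 1 covers an empty \<open>T\<close>.\<close>
  define c0 where "c0 = Min (insert 1 (c ` T))"
  have c0: "c0 > 0" using c(1) by (simp add: c0_def)
  have c0_le: "c0 \<le> c e" if "e \<in> T" for e using that by (simp add: c0_def)
  obtain v where v: "v \<ge> 0" "frob_norm_sq (off_diag \<Lambda>0) = ennreal v"
    using assms(6) by (cases "frob_norm_sq (off_diag \<Lambda>0)") auto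
  \<comment> \<open>The bound 1/2 permits the column scaling, \<open>c0\<close> activates the lower
    bounds, and the last term gives \<open>4 * \<epsilon>^2 * v < c0\<close>, where
    \<open>v + 1\<close> avoids a zero divisor.\<close>
  define r where "r = min (1/2) (min c0 (c0 / (4 * (v + 1))))"
  have r: "r > 0" using c0 v by (simp add: r_def)
  have upper: "delta_sq (perturbed Gt \<Lambda>0 \<epsilon>) a < ennreal c0"
    if \<epsilon>: "0 \<le> \<epsilon>" "\<epsilon> < r" and a: "allowable T a" for \<epsilon> a
  proof -
    have "\<epsilon> \<le> 1/2" using \<epsilon> by (simp add: r_def)
    have "delta_sq (perturbed Gt \<Lambda>0 \<epsilon>) a \<le> delta_sq (perturbed Gt \<Lambda>0 \<epsilon>) T"
      using a by (intro delta_sq_antimono) (simp add: allowable_def)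
    also have "\<dots> \<le> ennreal (4 * \<epsilon>\<^sup>2) * ennreal v"
      using delta_sq_true_structure_le[OF assms(1-4) \<Lambda> \<epsilon>(1) \<open>\<epsilon> \<le> 1/2\<close>] v by (simp add: T_def)
    also have "\<dots> = ennreal (4 * \<epsilon>\<^sup>2 * v)" using v by (simp add: ennreal_mult)
    also have "\<dots> < ennreal c0"
    proof (rule ennreal_lessI[OF c0])
      have "\<epsilon>\<^sup>2 * v \<le> \<epsilon> * (v + 1)"
        unfolding power2_eq_square using \<epsilon>(1) \<open>\<epsilon> \<le> 1/2\<close> v(1)
        by (intro mult_mono mult_left_le) auto
      moreover have "\<epsilon> < c0 / (4 * (v + 1))" using \<epsilon> by (simp add: r_def)
      then have "4 * (\<epsilon> * (v + 1)) < c0" using v by (simp add: field_simps)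
      ultimately show "4 * \<epsilon>\<^sup>2 * v < c0" by linarith
    qed
    finally show ?thesis .
  qed
  have lower: "ennreal c0 \<le> delta_sq (perturbed Gt \<Lambda>0 \<epsilon>) n"
    if \<epsilon>: "0 \<le> \<epsilon>" "\<epsilon> < r" and n: "non_allowable T n" for \<epsilon> n
  proof -
    obtain e where e: "e \<in> T" "e \<notin> n" using n by (auto simp: non_allowable_def allowable_def)
    have "\<epsilon> < c e" using \<epsilon> c0_le[OF e(1)] by (simp add: r_def)
    then show ?thesis
      using c(2)[OF e(1) \<epsilon>(1) _ e(2)] ennreal_leI[OF c0_le[OF e(1)]] by (meson order_trans)
  qed
  have solvable: "M2_solvable (perturbed Gt \<Lambda>0 \<epsilon>) T" if "0 \<le> \<epsilon>" "\<epsilon> < r" for \<epsilon>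
    by (rule M2_solvable_if_separated[OF T]) (use upper lower that in \<open>meson order_less_le_trans\<close>)
  \<comment> \<open>\<open>F\<close> is what the required identity leaves for
    \<open>B n = C + 1\<close>. For \<open>0 \<le> \<epsilon> < r\<close> all distances are at most
    \<open>C\<close>, so \<open>enn2real\<close> loses nothing.\<close>
  define F where "F n a \<epsilon> = enn2real (delta_sq (perturbed Gt \<Lambda>0 \<epsilon>) n)
      - enn2real (delta_sq (perturbed Gt \<Lambda>0 \<epsilon>) a) - (C + 1)" for n a \<epsilon>
  have F: "enn2ereal (delta_sq (perturbed Gt \<Lambda>0 \<epsilon>) n) - enn2ereal (delta_sq (perturbed Gt \<Lambda>0 \<epsilon>) a)
      = ereal (C + 1 + F n a \<epsilon>) \<and> \<bar>F n a \<epsilon>\<bar> < C + 1"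
    if n: "non_allowable T n" and a: "allowable T a" and \<epsilon>: "0 \<le> \<epsilon>" "\<epsilon> < r" for n a \<epsilon>
  proof -
    define \<delta> where "\<delta> i = enn2real (delta_sq (perturbed Gt \<Lambda>0 \<epsilon>) i)" for i
    have C_bound: "delta_sq (perturbed Gt \<Lambda>0 \<epsilon>) i \<le> ennreal C" for i
      using C(2) \<epsilon> by (simp add: r_def)
    have "delta_sq (perturbed Gt \<Lambda>0 \<epsilon>) i < \<infinity>" for i
      using order_le_less_trans[OF C_bound ennreal_less_top] by simp
    then have \<delta>: "delta_sq (perturbed Gt \<Lambda>0 \<epsilon>) i = ennreal (\<delta> i)" for i
      by (simp add: \<delta>_def)
    have \<delta>0: "\<delta> i \<ge> 0" for i by (simp add: \<delta>_def)
    have "ennreal (\<delta> a) < ennreal (\<delta> n)"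
      using order_less_le_trans[OF upper[OF \<epsilon> a] lower[OF \<epsilon> n]] unfolding \<delta> .
    then have "\<delta> a < \<delta> n" using \<delta>0 by (simp add: ennreal_less_iff)
    moreover have "\<delta> n \<le> C" using C_bound[of n] C(1) unfolding \<delta> by (simp add: ennreal_le_iff)
    moreover have F: "F n a \<epsilon> = \<delta> n - \<delta> a - (C + 1)" by (simp add: F_def \<delta>_def)
    \<comment> \<open>Strict separation gives \<open>F n a \<epsilon> > -(C + 1)\<close>, and
      \<open>\<delta> n \<le> C\<close> gives \<open>F n a \<epsilon> \<le> -1\<close>.\<close>
    ultimately have "\<bar>F n a \<epsilon>\<bar> < C + 1" using \<delta>0[of a] by linarith
    then show ?thesis unfolding \<delta> by (simp add: F enn2ereal_ennreal \<delta>0)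
  qed
  show ?thesis
    unfolding T_def[symmetric]
  proof (intro exI[of _ r] conjI exI[of _ "\<lambda>_. C + 1"] exI[of _ F])
    show "\<forall>\<epsilon>. 0 \<le> \<epsilon> \<and> \<epsilon> < r \<longrightarrow> M2_solvable (perturbed Gt \<Lambda>0 \<epsilon>) T"
      using solvable by blast
  qed (use r F C(1) in auto)
qed

end
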